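(* Let $\mathscr{M}$ be the species of graphs without endpoints, $\mathscr{M}^c$ the species of connected graphs without endpoints, $\mathscr{Q}$ the species of co-point-determining graphs, and $\mathscr{Q}^c$ the species of connected co-point-determining graphs. Then their type generating series satisfy $$\widetilde{\mathscr{M}}(x)=\widetilde{\mathscr{Q}}(x),\qquad \widetilde{\mathscr{M}^c}(x)=\widetilde{\mathscr{Q}^c}(x).$$
   Context: All graphs are finite and simple. For a species $F$ of graphs (a class of graphs closed under isomorphism), the type generating series is $\widetilde F(x)=\sum_{n\ge0}f_n x^n$, where $f_n$ is the number of unlabeled $F$-structures of order $n$, i.e. isomorphism classes of graphs in $F$ with $n$ vertices. A graph without endpoints is a graph with no vertex of degree one (the empty graph is included). A graph is point-determining if distinct vertices have distinct neighborhoods (the neighborhood of a vertex being the set of vertices adjacent to it), and co-point-determining if its complement is point-determining; the empty graph is regarded as co-point-determining. The empty graph is not considered connected. *)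

theory Defs
  imports
    "HOL-Computational_Algebra.Formal_Power_Series"
    "Graph_Theory.Graph_Theory"
begin

text \<open>
  A finite simple graph is a \<open>pair_graph\<close>: a finite, loop-free, symmetric digraph whose arcs are
  ordered pairs of vertices, so that an edge is a pair of opposite arcs. The empty graph is allowed.
  Vertices are natural numbers, so that every finite graph has an isomorphic copy.
\<close>

definition graph_iso :: "(nat pair_pre_digraph \<times> nat pair_pre_digraph) set" where
  "graph_iso =
     {(G, H). pair_graph G \<and> pair_graph H \<and> digraph_iso (with_proj G) (with_proj H)}"

definition unlabeled_structures ::
    "nat pair_pre_digraph set \<Rightarrow> nat \<Rightarrow> nat pair_pre_digraph set set" where
  "unlabeled_structures F n = {G \<in> F. card (pverts G) = n} // graph_iso"

definition type_gen_series :: "nat pair_pre_digraph set \<Rightarrow> int fps" where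
  "type_gen_series F = Abs_fps (\<lambda>n. int (card (unlabeled_structures F n)))"

lemma graph_iso_iff:
  "(G, H) \<in> graph_iso \<longleftrightarrow> pair_graph G \<and> pair_graph H \<and>
     (\<exists>h. bij_betw h (pverts G) (pverts H) \<and>
          (\<forall>u \<in> pverts G. \<forall>v \<in> pverts G. (u, v) \<in> parcs G \<longleftrightarrow> (h u, h v) \<in> parcs H))"
  (is "?L \<longleftrightarrow> ?R")
proof
  assume L: ?L
  then interpret G: pair_graph G by (simp add: graph_iso_def)
  from L obtain f where f: "G.digraph_isomorphism f" and H: "with_proj H = app_iso f (with_proj G)"
    by (auto simp: graph_iso_def digraph_iso_def)
  let ?h = "iso_verts f"
  have inj: "inj_on ?h (pverts G)"
    using f by (simp add: G.digraph_isomorphism_def)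
  have pv: "pverts H = ?h ` pverts G"
    using arg_cong[OF H, of verts] by simp
  have pa: "parcs H = (\<lambda>(u, v). (?h u, ?h v)) ` parcs G"
    using G.arcs_ends_app_iso_eq[OF f] arg_cong[OF H, of arcs_ends] by simp
  have "(u, v) \<in> parcs G \<longleftrightarrow> (?h u, ?h v) \<in> parcs H"
    if uv: "u \<in> pverts G" "v \<in> pverts G" for u v
  proof
    assume "(u, v) \<in> parcs G"
    then show "(?h u, ?h v) \<in> parcs H"
      unfolding pa by (rule rev_image_eqI) simp
  next
    assume "(?h u, ?h v) \<in> parcs H"
    then obtain x y where xy: "(x, y) \<in> parcs G" "?h x = ?h u" "?h y = ?h v"
      unfolding pa by auto
    have "x = u" "y = v"
      using inj uv xy G.in_arcsD1[OF xy(1)] G.in_arcsD2[OF xy(1)] by (auto dest: inj_onD)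
    then show "(u, v) \<in> parcs G" using xy(1) by simp
  qed
  then show ?R
    using L inj pv unfolding graph_iso_def bij_betw_def by blast
next
  assume R: ?R
  then interpret G: pair_graph G by simp
  from R interpret H: pair_graph H by simp
  from R obtain h where h: "bij_betw h (pverts G) (pverts H)"
    and e: "\<And>u v. u \<in> pverts G \<Longrightarrow> v \<in> pverts G \<Longrightarrow> (u, v) \<in> parcs G \<longleftrightarrow> (h u, h v) \<in> parcs H"
    by blast
  have inj: "inj_on h (pverts G)" and im: "pverts H = h ` pverts G"
    using h by (auto simp: bij_betw_def)
  let ?f = "\<lparr>iso_verts = h, iso_arcs = map_prod h h, iso_head = snd, iso_tail = fst\<rparr>"
  have "parcs G \<subseteq> pverts G \<times> pverts G"
    using G.in_arcsD1 G.in_arcsD2 by auto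
  then have "inj_on (map_prod h h) (parcs G)"
    using inj by (metis inj_on_subset map_prod_inj_on)
  then have f: "G.digraph_isomorphism ?f"
    using inj G.wf_digraph by (simp add: G.digraph_isomorphism_def)
  have "parcs H = map_prod h h ` parcs G"
  proof (intro set_eqI iffI)
    fix x assume x: "x \<in> parcs H"
    then have "fst x \<in> h ` pverts G" "snd x \<in> h ` pverts G"
      using H.arc_fst_in_verts[OF x] H.arc_snd_in_verts[OF x] by (simp_all only: im)
    then obtain u v where uv: "x = (h u, h v)" "u \<in> pverts G" "v \<in> pverts G"
      by (cases x) auto
    then have "(u, v) \<in> parcs G"
      using e[of u v] x by simp
    then show "x \<in> map_prod h h ` parcs G"
      using uv(1) by (simp add: rev_image_eqI)
  next
    fix x assume "x \<in> map_prod h h ` parcs G"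
    then obtain u v where "x = (h u, h v)" and uv: "(u, v) \<in> parcs G"
      by auto
    then show "x \<in> parcs H"
      using e[OF G.in_arcsD1[OF uv] G.in_arcsD2[OF uv]] by simp
  qed
  then have "with_proj H = app_iso ?f (with_proj G)"
    using im by (simp add: with_proj_def app_iso_def)
  with f have "digraph_iso (with_proj G) (with_proj H)"
    unfolding digraph_iso_def by blast
  then show ?L
    using G.pair_graph H.pair_graph by (simp add: graph_iso_def)
qed

lemma equiv_graph_iso: "equiv {G. pair_graph G} graph_iso"
proof (rule equivI)
  show "graph_iso \<subseteq> {G. pair_graph G} \<times> {G. pair_graph G}"
    by (auto simp: graph_iso_def)
  show "refl_on {G. pair_graph G} graph_iso"
  proof (rule refl_onI)
    fix G :: "nat pair_pre_digraph" assume "G \<in> {G. pair_graph G}"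
    moreover have "bij_betw id (pverts G) (pverts G)"
      by simp
    ultimately show "(G, G) \<in> graph_iso"
      unfolding graph_iso_iff by (intro conjI exI[of _ id]) simp_all
  qed
  show "sym graph_iso"
  proof (rule symI)
    fix G H assume GH: "(G, H) \<in> graph_iso"
    then interpret pair_graph G by (simp add: graph_iso_def)
    show "(H, G) \<in> graph_iso"
      using GH digraph_iso_swap[OF wf_digraph, of "with_proj H"] by (simp add: graph_iso_def)
  qed
  show "trans graph_iso"
    by (rule transI) (unfold graph_iso_def, blast intro: digraph_iso_trans)
qed

text \<open>The counted sets are finite, so their cardinalities are meaningful.\<close>

lemma finite_unlabeled_structures:
  assumes "F \<subseteq> {G. pair_graph G}"
  shows "finite (unlabeled_structures F n)"
proof -
  let ?S = "{H :: nat pair_pre_digraph. pverts H = {..<n} \<and> parcs H \<subseteq> {..<n} \<times> {..<n}}"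
  have "?S \<subseteq> (\<lambda>E. \<lparr>pverts = {..<n}, parcs = E\<rparr>) ` Pow ({..<n} \<times> {..<n})"
  proof
    fix H assume "H \<in> ?S"
    then have "H = \<lparr>pverts = {..<n}, parcs = parcs H\<rparr>" "parcs H \<in> Pow ({..<n} \<times> {..<n})"
      by auto
    then show "H \<in> (\<lambda>E. \<lparr>pverts = {..<n}, parcs = E\<rparr>) ` Pow ({..<n} \<times> {..<n})"
      by (rule image_eqI)
  qed
  then have fin: "finite ?S"
    by (rule finite_subset) simp
  have "unlabeled_structures F n \<subseteq> (\<lambda>H. graph_iso `` {H}) ` ?S"
  proof
    fix C assume "C \<in> unlabeled_structures F n"
    then obtain G where G: "G \<in> F" "card (pverts G) = n" and C: "C = graph_iso `` {G}"
      by (auto simp: unlabeled_structures_def quotient_def)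
    interpret G: pair_graph G using G assms by auto
    obtain h where h: "bij_betw h (pverts G) {..<n}"
      using ex_bij_betw_finite_nat[OF G.pair_finite_verts] G(2) by (auto simp: atLeast0LessThan)
    then have inj: "inj_on h (pverts G)" and hv: "\<And>u. u \<in> pverts G \<Longrightarrow> h u < n"
      by (auto simp: bij_betw_def)
    define H where "H = \<lparr>pverts = {..<n}, parcs = map_prod h h ` parcs G\<rparr>"
    have HS: "H \<in> ?S"
      using hv G.in_arcsD1 G.in_arcsD2 by (auto simp: H_def)
    have "pair_graph H"
    proof
      show "finite (parcs H)" "finite (pverts H)"
        using G.pair_finite_arcs by (auto simp: H_def)
      fix x assume "x \<in> parcs H"
      then obtain u v where x: "x = (h u, h v)" "(u, v) \<in> parcs G"
        by (auto simp: H_def)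
      then show "fst x \<in> pverts H" "snd x \<in> pverts H"
        using hv G.in_arcsD1 G.in_arcsD2 by (auto simp: H_def)
      show "fst x \<noteq> snd x"
        using x inj G.no_loops' G.in_arcsD1 G.in_arcsD2 by (auto dest!: inj_onD)
    next
      show "symmetric (with_proj H)"
        unfolding symmetric_def
      proof (rule symI)
        fix x y assume "(x, y) \<in> arcs_ends (with_proj H)"
        then obtain u v where "x = h u" "y = h v" "(u, v) \<in> parcs G"
          by (auto simp: H_def)
        then show "(y, x) \<in> arcs_ends (with_proj H)"
          using G.arcs_symmetric[of u v] by (simp add: H_def rev_image_eqI)
      qed
    qed
    moreover have "(u, v) \<in> parcs G \<longleftrightarrow> (h u, h v) \<in> parcs H"
      if uv: "u \<in> pverts G" "v \<in> pverts G" for u v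
    proof
      assume "(u, v) \<in> parcs G"
      then show "(h u, h v) \<in> parcs H"
        by (simp add: H_def rev_image_eqI)
    next
      assume "(h u, h v) \<in> parcs H"
      then obtain x y where xy: "(x, y) \<in> parcs G" "h x = h u" "h y = h v"
        by (auto simp: H_def)
      have "x = u" "y = v"
        using inj uv xy G.in_arcsD1[OF xy(1)] G.in_arcsD2[OF xy(1)] by (auto dest: inj_onD)
      then show "(u, v) \<in> parcs G" using xy(1) by simp
    qed
    ultimately have "(G, H) \<in> graph_iso"
      using h G.pair_graph by (auto simp: graph_iso_iff H_def)
    then have "C = graph_iso `` {H}"
      unfolding C by (rule equiv_class_eq[OF equiv_graph_iso])
    then show "C \<in> (\<lambda>H. graph_iso `` {H}) ` ?S"
      using HS by blast
  qed
  then show ?thesis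
    using fin by (blast intro: finite_surj)
qed

definition neighborhood :: "'a pair_pre_digraph \<Rightarrow> 'a \<Rightarrow> 'a set" where
  "neighborhood G v = {u \<in> pverts G. (v, u) \<in> parcs G}"

definition graph_complement :: "'a pair_pre_digraph \<Rightarrow> 'a pair_pre_digraph" where
  "graph_complement G =
     \<lparr>pverts = pverts G,
      parcs = {(u, v). u \<in> pverts G \<and> v \<in> pverts G \<and> u \<noteq> v \<and> (u, v) \<notin> parcs G}\<rparr>"

definition point_determining :: "'a pair_pre_digraph \<Rightarrow> bool" where
  "point_determining G \<longleftrightarrow>
     (\<forall>u \<in> pverts G. \<forall>v \<in> pverts G. u \<noteq> v \<longrightarrow> neighborhood G u \<noteq> neighborhood G v)"

definition co_point_determining :: "'a pair_pre_digraph \<Rightarrow> bool" where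
  "co_point_determining G \<longleftrightarrow> point_determining (graph_complement G)"

text \<open>
  In a symmetric digraph the out-degree is the degree of the underlying undirected graph.
\<close>

definition without_endpoints :: "'a pair_pre_digraph \<Rightarrow> bool" where
  "without_endpoints G \<longleftrightarrow> (\<forall>v \<in> pverts G. out_degree (with_proj G) v \<noteq> 1)"

text \<open>
  The graph-theoretic \<open>connected\<close> (false for the empty graph) is qualified because
  \<open>Topological_Spaces\<close> has a constant of the same name.
\<close>

definition connected_graph :: "'a pair_pre_digraph \<Rightarrow> bool" where
  "connected_graph G \<longleftrightarrow> Digraph_Component.connected (with_proj G)"

definition \<M> :: "nat pair_pre_digraph set" where
  "\<M> = {G. pair_graph G \<and> without_endpoints G}"

definition \<M>c :: "nat pair_pre_digraph set" where
  "\<M>c = {G. pair_graph G \<and> connected_graph G \<and> without_endpoints G}"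

definition \<Q> :: "nat pair_pre_digraph set" where
  "\<Q> = {G. pair_graph G \<and> co_point_determining G}"

definition \<Q>c :: "nat pair_pre_digraph set" where
  "\<Q>c = {G. pair_graph G \<and> connected_graph G \<and> co_point_determining G}"

end

theory Submission
  imports Defs "HOL-Combinatorics.Combinatorics"
begin

text \<open>
  By Burnside's lemma, \<open>n!\<close> times the number of isomorphism classes of order \<open>n\<close> with a given
  property is the sum of \<open>\<bar>Aut E\<bar>\<close> over the graphs \<open>E\<close> on \<open>{..<n}\<close> with that property. Moreover, a graph
  is co-point-determining iff it has no closed twins, that is, no two vertices with the same closed
  neighborhood. So it suffices that \<open>\<bar>Aut E\<bar>\<close> has the same sum over the graphs without leaves as over
  the graphs without closed twins. Both sums are evaluated as one signed sum.

  Consider triples \<open>(E, P, f)\<close>, where \<open>P\<close> is a set of disjoint ordered pairs \<open>(s, t)\<close> of vertices and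
  \<open>f\<close> is an automorphism of both \<open>E\<close> and \<open>P\<close>. The weight is \<open>- 1\<close> to the number of cycles of \<open>f\<close> on the
  sources \<open>s\<close>. There are two versions: every source \<open>s\<close> is a leaf attached to \<open>t\<close>, or
  every source \<open>s\<close> is a closed twin of \<open>t\<close>. For fixed \<open>P\<close>, turning leaves at \<open>t\<close> into copies of \<open>t\<close>
  is a bijection between the graphs of the two versions which keeps \<open>f\<close> and does not change
  reachability (\<open>sum_pendant_eq_sum_twinned\<close>). Hence the two signed sums agree, and they still agree
  when \<open>E\<close> is required to be connected.

  On the leaf side (\<open>sum_pendant_matchings\<close>), fix \<open>E\<close>. The matching is determined by its set of
  sources, a set \<open>S\<close> of leaves in which no two leaves are adjacent or have a common neighbor. The other
  sets of leaves may be added at no cost: if \<open>S\<close> contains two such leaves, exchanging them is an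
  automorphism, and composing \<open>f\<close> with it reverses the sign. For a fixed \<open>f\<close>, the sum over all
  \<open>f\<close>-invariant sets of leaves is an inclusion-exclusion sum over cycles, which vanishes unless there
  is no leaf (\<open>sum_signed_weight_invariant_subsets\<close>).

  On the twin side (\<open>sum_twinned_matchings\<close>), fix \<open>E\<close> again. If \<open>P\<close> has two pairs in the same class of
  closed twins, exchanging these pairs reverses the sign. In the remaining triples, the pairs of \<open>P\<close>
  lie in different classes, and all choices of the pair in a class are equivalent under permutations
  within the class. So the pairs \<open>(P, f)\<close> correspond to the pairs of an automorphism \<open>g\<close> and a
  \<open>g\<close>-invariant set of classes with at least two elements. Inclusion-exclusion over these classes leaves
  exactly the graphs without closed twins.

  In the language of species, both sides substitute into the cycle index series of graphs a virtual
  species with type generating series \<open>x - x\<^sup>2\<close>: the species \<open>X \<cdot> E(- X)\<close> of a vertex with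
  negatively counted leaves on the one side, up to a correction for components with a single edge that
  vanishes for unlabeled graphs, and the inverse under substitution of the species of nonempty sets on
  the other.
\<close>

section \<open>Invariant subsets counted with sign\<close>

text \<open>
  A cycle of length \<open>l\<close> contributes \<open>(- 1) ^ l\<close> to the first factor and \<open>(- 1) ^ (l - 1)\<close> to the
  second one. So if \<open>f\<close> permutes the finite set \<open>S\<close>, this is \<open>- 1\<close> to the number of cycles of \<open>f\<close> on
  \<open>S\<close>. The form with the sign makes the effect of a transposition evident.
\<close>

definition signed_weight :: "'a set \<Rightarrow> ('a \<Rightarrow> 'a) \<Rightarrow> int" where
  "signed_weight S f = (- 1) ^ card S * sign_on S f"

lemma signed_weight_conj:
  assumes "finite D" "bij_betw f D D" "inj_on g D" "\<And>x. x \<in> D \<Longrightarrow> h (g x) = g (f x)"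
  shows "signed_weight (g ` D) h = signed_weight D f"
proof -
  have p: "restrict_id f D permutes D"
    using assms(2) by (rule permutes_restrict_id)
  have "map_permutation D g (restrict_id f D) = restrict_id h (g ` D)"
    using assms(3,4) by (auto simp: map_permutation_def restrict_id_def fun_eq_iff)
  then have "sign_on (g ` D) h = sign_on D f"
    using sign_map_permutation[OF assms(3) p assms(1)] by (simp add: sign_on_def)
  then show ?thesis
    using card_image[OF assms(3)] by (simp add: signed_weight_def)
qed

lemma signed_weight_transpose:
  assumes "finite S" "bij_betw f S S" "u \<in> S" "v \<in> S" "u \<noteq> v"
    and "\<And>x. x \<in> S \<Longrightarrow> t x = transpose u v x"
  shows "signed_weight S (t \<circ> f) = - signed_weight S f"
proof -
  have "sign_on S (t \<circ> f) = sign_on S (transpose u v \<circ> f)"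
    using assms(2,6) by (intro sign_on_cong) (auto simp: bij_betw_def)
  also have "\<dots> = - sign_on S f"
    using assms by (subst sign_on_compose) (auto simp: sign_on_transpose permutes_imp_bij permutes_swap_id)
  finally show ?thesis by (simp add: signed_weight_def)
qed

lemma signed_weight_union:
  assumes "finite S" "finite T" "S \<inter> T = {}" "bij_betw f S S" "bij_betw f T T"
  shows "signed_weight (S \<union> T) f = signed_weight S f * signed_weight T f"
proof -
  have p: "restrict_id f S permutes S" "restrict_id f T permutes T"
    using assms by (auto intro: permutes_restrict_id)
  have "restrict_id f (S \<union> T) = restrict_id f S \<circ> restrict_id f T"
    using assms(3) bij_betwE[OF assms(5)]
    by (auto simp: fun_eq_iff restrict_id_def)
  then have "sign_on (S \<union> T) f = sign_on S f * sign_on T f"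
    using p assms(1,2) by (simp add: sign_on_def sign_compose permutes_imp_permutation)
  then show ?thesis
    using assms(1-3) by (simp add: signed_weight_def card_Un_disjoint power_add)
qed

lemma sign_cycle_of_list: "cs \<noteq> [] \<Longrightarrow> distinct cs \<Longrightarrow> sign (cycle_of_list cs) = (- 1) ^ (length cs - 1)"
  by (induction cs rule: cycle_of_list.induct)
     (auto simp: sign_compose permutation_of_cycle permutation_swap_id sign_swap_id)

lemma sum_eq_0_if_sign_reversing:
  fixes w :: "'b \<Rightarrow> int"
  assumes "finite X" and "\<And>x. x \<in> X \<Longrightarrow> i x \<in> X \<and> i (i x) = x \<and> w (i x) = - w x"
  shows "sum w X = 0"
proof -
  have "sum w X = sum (\<lambda>x. - w x) X"
    by (rule sum.reindex_bij_witness[of _ i i]) (use assms in auto)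
  then show ?thesis by (simp add: sum_negf)
qed

text \<open>
  The invariant subsets are the unions of cycles, so this is the sum of \<open>(- 1) ^ card D\<close> over all
  sets \<open>D\<close> of cycles. Adding or removing the cycle of one fixed element \<open>a\<close> pairs off the terms.
\<close>

lemma sum_signed_weight_invariant_subsets:
  assumes "finite L" "bij_betw f L L"
  shows "(\<Sum>S | S \<subseteq> L \<and> f ` S = S. signed_weight S f) = (if L = {} then 1 else 0)"
proof (cases "L = {}")
  case True
  then have "{S. S \<subseteq> L \<and> f ` S = S} = {{}}" by auto
  then show ?thesis using True by (simp add: signed_weight_def sign_on_def restrict_id_def)
next
  case False
  then obtain a where a: "a \<in> L" by blast
  define p where "p = restrict_id f L"
  have pp: "p permutes L" unfolding p_def using assms(2) by (rule permutes_restrict_id)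
  then have perm: "permutation p" using assms(1) by (rule permutes_imp_permutation[rotated])
  have pf: "p x = f x" if "x \<in> L" for x using that by (simp add: p_def restrict_id_def)
  define cs where "cs = support p a"
  have dist: "distinct cs" unfolding cs_def using perm by (rule cycle_of_permutation)
  define Z where "Z = set cs"
  have Zrng: "Z = range (\<lambda>i. (p ^^ i) a)" unfolding Z_def cs_def using perm by (rule support_set)
  have ZL: "Z \<subseteq> L" unfolding Zrng using permutes_funpow[OF pp] a by (auto simp: permutes_in_image)
  have aZ: "a \<in> Z" unfolding Zrng by (metis funpow_0 rangeI)
  have finZ: "finite Z" by (simp add: Z_def)
  have cyc: "f b = cycle_of_list cs b" if "b \<in> Z" for b
    using cycle_restrict[OF perm, of b a] that ZL pf[of b] by (auto simp: Z_def cs_def)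
  have injL: "inj_on f L" using assms(2) by (simp add: bij_betw_def)
  have "f ` Z = cycle_of_list cs ` Z"
    using cyc by (intro image_cong) auto
  then have fZ: "f ` Z = Z" using permutes_image[OF cycle_permutes[of cs]] by (simp add: Z_def)
  have wZ: "signed_weight Z f = - 1"
  proof -
    have "sign_on Z f = sign_on Z (cycle_of_list cs)"
      using cyc by (intro sign_on_cong) auto
    also have "\<dots> = sign (cycle_of_list cs)"
      by (rule sign_on_permutes[of _ Z]) (simp_all add: Z_def cycle_permutes)
    also have "\<dots> = (- 1) ^ (length cs - 1)"
      using aZ dist by (intro sign_cycle_of_list) (auto simp: Z_def)
    finally have s: "sign_on Z f = (- 1) ^ (length cs - 1)" .
    obtain m where m: "length cs = Suc m" using aZ by (cases cs) (auto simp: Z_def)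
    have "card Z = Suc m" using distinct_card[OF dist] m by (simp add: Z_def)
    then show ?thesis using s m by (simp add: signed_weight_def flip: power_add mult_2)
  qed
  have bij: "bij_betw f S S" if "S \<subseteq> L" "f ` S = S" for S
    using that injL by (auto simp: bij_betw_def intro: inj_on_subset)
  \<comment> \<open>an invariant set contains the cycle of \<open>a\<close> or misses it\<close>
  have cases: "Z \<subseteq> S \<or> Z \<inter> S = {}" if S: "S \<subseteq> L" "f ` S = S" for S
  proof -
    have "p ` S = S" using S pf by (metis image_cong subset_eq)
    then have "(p ^^ i) a \<in> S \<longleftrightarrow> a \<in> S" for i
      using permutes_inj[OF pp] by (induction i) (auto simp: inj_image_mem_iff dest: injD)
    then show ?thesis unfolding Zrng by auto
  qed
  let ?i = "\<lambda>S. if Z \<subseteq> S then S - Z else S \<union> Z"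
  have "(\<Sum>S | S \<subseteq> L \<and> f ` S = S. signed_weight S f) = 0"
  proof (rule sum_eq_0_if_sign_reversing[where i = ?i])
    show "finite {S. S \<subseteq> L \<and> f ` S = S}" using assms(1) by simp
  next
    fix S assume "S \<in> {S. S \<subseteq> L \<and> f ` S = S}"
    then have S: "S \<subseteq> L" "f ` S = S" by auto
    have finS: "finite S" using S assms(1) finite_subset by blast
    show "?i S \<in> {S. S \<subseteq> L \<and> f ` S = S} \<and> ?i (?i S) = S \<and> signed_weight (?i S) f = - signed_weight S f"
    proof (cases "Z \<subseteq> S")
      case True
      have im: "f ` (S - Z) = S - Z"
        using inj_on_image_set_diff[OF injL, of S Z] S ZL fZ by auto
      have "signed_weight ((S - Z) \<union> Z) f = signed_weight (S - Z) f * signed_weight Z f"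
        using S ZL im fZ finS finZ by (intro signed_weight_union bij) auto
      then have "signed_weight S f = - signed_weight (S - Z) f" using wZ True by (simp add: Un_absorb2)
      then show ?thesis using True S ZL im aZ by auto
    next
      case False
      then have disj: "Z \<inter> S = {}" using cases S by blast
      have "signed_weight (S \<union> Z) f = signed_weight S f * signed_weight Z f"
        using S ZL fZ finS finZ disj by (intro signed_weight_union bij) auto
      then show ?thesis using False S ZL fZ wZ disj by (auto simp: image_Un)
    qed
  qed
  then show ?thesis using False by simp
qed

section \<open>Automorphisms and matchings\<close>

definition simple_graphs :: "'a set \<Rightarrow> 'a rel set" where
  "simple_graphs V = {E. E \<subseteq> V \<times> V \<and> sym E \<and> irrefl E}"

text \<open>
  The relation is arbitrary because the same notion is applied to graphs and to matchings.
\<close>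

definition auts :: "'a set \<Rightarrow> 'a rel \<Rightarrow> ('a \<Rightarrow> 'a) set" where
  "auts V R = {f. f permutes V \<and> (\<forall>u v. (f u, f v) \<in> R \<longleftrightarrow> (u, v) \<in> R)}"

lemma finite_auts: "finite V \<Longrightarrow> finite (auts V R)"
  by (rule finite_subset[OF _ finite_permutations[of V]]) (auto simp: auts_def)

lemma autsD: "f \<in> auts V R \<Longrightarrow> f permutes V" "f \<in> auts V R \<Longrightarrow> (f u, f v) \<in> R \<longleftrightarrow> (u, v) \<in> R"
  by (simp_all add: auts_def)

lemma auts_comp: "f \<in> auts V R \<Longrightarrow> g \<in> auts V R \<Longrightarrow> f \<circ> g \<in> auts V R"
  by (simp add: auts_def permutes_compose)

lemma auts_inv: "f \<in> auts V R \<Longrightarrow> inv f \<in> auts V R"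
  unfolding auts_def by (auto simp: permutes_inv) (metis permutes_inverses(1))+

lemma autsI_finite:
  assumes "f permutes V" "finite R" "\<And>u v. (u, v) \<in> R \<Longrightarrow> (f u, f v) \<in> R"
  shows "f \<in> auts V R"
proof -
  have inj: "inj f" using assms(1) by (rule permutes_inj)
  have "map_prod f f ` R = R"
    using assms(2,3) inj by (intro endo_inj_surj) (auto simp: inj_on_def dest: injD)
  then have "(u, v) \<in> R" if "(f u, f v) \<in> R" for u v
  proof -
    have "(f u, f v) \<in> map_prod f f ` R" using that \<open>map_prod f f ` R = R\<close> by simp
    then show ?thesis using inj by (auto dest: injD)
  qed
  then show ?thesis using assms(1,3) unfolding auts_def by blast
qed

text \<open>
  Each pair is ordered: it has a source, which carries the sign, and a target. With both pairs equal,
  the first condition excludes \<open>s = t\<close>.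
\<close>

definition matching :: "'a set \<Rightarrow> 'a rel \<Rightarrow> bool" where
  "matching V P \<longleftrightarrow> P \<subseteq> V \<times> V \<and>
     (\<forall>(s, t) \<in> P. \<forall>(s', t') \<in> P. s \<noteq> t' \<and> (s = s' \<longleftrightarrow> t = t'))"

lemma matchingD:
  assumes "matching V P" "(s, t) \<in> P" "(s', t') \<in> P"
  shows "s \<noteq> t'" "s = s' \<longleftrightarrow> t = t'" "s \<in> V" "t \<in> V"
  using assms unfolding matching_def by blast+

definition pendant :: "'a rel \<Rightarrow> 'a rel \<Rightarrow> bool" where
  "pendant E P \<longleftrightarrow> (\<forall>(s, t) \<in> P. E `` {s} = {t})"

text \<open>
  The set \<open>E\<^sup>= `` {u}\<close> is the closed neighborhood of \<open>u\<close>.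
\<close>

definition closed_twins :: "'a rel \<Rightarrow> 'a \<Rightarrow> 'a \<Rightarrow> bool" where
  "closed_twins E u v \<longleftrightarrow> (\<forall>w. (u, w) \<in> E\<^sup>= \<longleftrightarrow> (v, w) \<in> E\<^sup>=)"

definition twinned :: "'a rel \<Rightarrow> 'a rel \<Rightarrow> bool" where
  "twinned E P \<longleftrightarrow> (\<forall>(s, t) \<in> P. closed_twins E s t)"

lemma auts_image_Domain:
  assumes "f \<in> auts V P"
  shows "f ` Domain P = Domain P"
proof -
  have "surj f" using autsD(1)[OF assms] by (rule permutes_surj)
  then show ?thesis using autsD(2)[OF assms] by (auto simp: surj_def) (metis Domain.simps image_eqI)
qed

lemma bij_betw_image_self: "f permutes V \<Longrightarrow> f ` S = S \<Longrightarrow> bij_betw f S S"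
  by (metis bij_betw_def inj_on_subset permutes_inj subset_UNIV)

section \<open>Sets of leaves\<close>

text \<open>
  If \<open>(u, v) \<in> E\<close>, then \<open>{u, v}\<close> is a connected component with a single edge. It is the only way in which a
  leaf can be attached to a leaf, and it has to be treated together with leaves at a common neighbor.
\<close>

lemma leaf_transpose_auts:
  assumes E: "E \<in> simple_graphs V" and "u \<in> V" "v \<in> V"
    and u: "E `` {u} = {x}" and v: "E `` {v} = {y}" and uv: "(u, v) \<in> E \<or> x = y"
  shows "transpose u v \<in> auts V E"
proof -
  have sym: "(a, b) \<in> E \<longleftrightarrow> (b, a) \<in> E" and irr: "(a, a) \<notin> E" for a b
    using E by (auto simp: simple_graphs_def sym_def irrefl_def)
  have nu: "(u, w) \<in> E \<longleftrightarrow> w = x" "(w, u) \<in> E \<longleftrightarrow> w = x" for w using u sym by blast+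
  have nv: "(v, w) \<in> E \<longleftrightarrow> w = y" "(w, v) \<in> E \<longleftrightarrow> w = y" for w using v sym by blast+
  have "(transpose u v a, transpose u v b) \<in> E \<longleftrightarrow> (a, b) \<in> E" for a b
  proof (cases "(u, v) \<in> E")
    case True
    then have "x = v" "y = u" using nu(1) nv(2) by metis+
    then show ?thesis using nu nv irr by (auto simp: transpose_def)
  next
    case False
    then have "x = y" "x \<noteq> v" "y \<noteq> u" "x \<noteq> u" "y \<noteq> v"
      using uv nu(1)[of v] nv(2)[of u] nu(1)[of x] nv(1)[of y] irr by auto
    then show ?thesis using nu nv by (auto simp: transpose_def)
  qed
  then show ?thesis using assms(2,3) by (simp add: auts_def permutes_swap_id)
qed

text \<open>
  The sources of a pendant matching form a set of leaves that is \<open>good\<close>: no two of them are adjacent or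
  have the same neighbor. Sets of leaves that are not good contribute nothing, by the transposition of
  two leaves, so that the sum extends to all sets of leaves and inclusion-exclusion applies.
\<close>

lemma sum_pendant_matchings:
  assumes V: "finite V" and E: "E \<in> simple_graphs V"
  shows "(\<Sum>P | matching V P \<and> pendant E P. \<Sum>f\<in>auts V E \<inter> auts V P. signed_weight (Domain P) f)
       = (if \<exists>v\<in>V. \<exists>t. E `` {v} = {t} then 0 else int (card (auts V E)))"
proof -
  define L where "L = {v \<in> V. \<exists>t. E `` {v} = {t}}"
  have finL: "finite L" using V by (simp add: L_def)
  have EV: "E \<subseteq> V \<times> V" and sym: "(a, b) \<in> E \<longleftrightarrow> (b, a) \<in> E" for a b
    using E by (auto simp: simple_graphs_def sym_def)
  define good where
    "good S \<longleftrightarrow> (\<forall>u\<in>S. \<forall>v\<in>S. (u, v) \<notin> E \<and> (E `` {u} = E `` {v} \<longrightarrow> u = v))" for S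
  let ?A = "\<lambda>S. {f \<in> auts V E. f ` S = S}"
  let ?w = "\<lambda>S. \<Sum>f\<in>?A S. signed_weight S f"
  have bad: "?w S = 0" if S: "S \<subseteq> L" "\<not> good S" for S
  proof -
    obtain u v where uv: "u \<in> S" "v \<in> S" "(u, v) \<in> E \<or> E `` {u} = E `` {v} \<and> u \<noteq> v"
      using S(2) unfolding good_def by blast
    have ne: "u \<noteq> v" using uv(3) E by (auto simp: simple_graphs_def irrefl_def)
    have "u \<in> L" "v \<in> L" using S(1) uv(1,2) by auto
    then obtain x y where xy: "E `` {u} = {x}" "E `` {v} = {y}" "u \<in> V" "v \<in> V"
      by (auto simp: L_def)
    then have "x = y" if "(u, v) \<notin> E" using that uv(3) by simp
    then have t: "transpose u v \<in> auts V E"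
      using xy by (intro leaf_transpose_auts[OF E]) auto
    have finS: "finite S" using S(1) finL finite_subset by blast
    have tS: "transpose u v ` S = S"
      using uv(1,2) by (intro permutes_image permutes_swap_id)
    show ?thesis
    proof (rule sum_eq_0_if_sign_reversing[where i = "\<lambda>f. transpose u v \<circ> f"])
      show "finite (?A S)" using finite_auts[OF V] by simp
      fix f assume f: "f \<in> ?A S"
      then have "bij_betw f S S" by (auto intro: bij_betw_image_self dest: autsD(1))
      then have "signed_weight S (transpose u v \<circ> f) = - signed_weight S f"
        using finS uv ne by (intro signed_weight_transpose) auto
      moreover have "transpose u v \<circ> (transpose u v \<circ> f) = f" by (simp add: fun_eq_iff)
      moreover have "(transpose u v \<circ> f) ` S = S" using f tS unfolding image_comp[symmetric] by simp
      then have "transpose u v \<circ> f \<in> ?A S" using f auts_comp[OF t] by simp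
      ultimately show "transpose u v \<circ> f \<in> ?A S \<and>
         transpose u v \<circ> (transpose u v \<circ> f) = f \<and> signed_weight S (transpose u v \<circ> f) = - signed_weight S f"
        by blast
    qed
  qed
  have "(\<Sum>P | matching V P \<and> pendant E P. \<Sum>f\<in>auts V E \<inter> auts V P. signed_weight (Domain P) f)
      = (\<Sum>S | S \<subseteq> L \<and> good S. ?w S)"
  proof (rule sum.reindex_bij_witness[of _ "\<lambda>S. E \<inter> S \<times> UNIV" Domain])
    fix P assume "P \<in> {P. matching V P \<and> pendant E P}"
    then have m: "matching V P" and p: "pendant E P" by auto
    have pE: "E `` {s} = {t}" if "(s, t) \<in> P" for s t using p that by (auto simp: pendant_def)
    have pE': "(s, w) \<in> E \<longleftrightarrow> w = t" if "(s, t) \<in> P" for s t w using pE[OF that] by auto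
    show P: "E \<inter> Domain P \<times> UNIV = P" using pE' by auto
    have "good (Domain P)"
      unfolding good_def
    proof (intro ballI conjI impI)
      fix u v assume "u \<in> Domain P" "v \<in> Domain P"
      then obtain x y where xy: "(u, x) \<in> P" "(v, y) \<in> P" by blast
      show "(u, v) \<notin> E" using pE'[OF xy(1)] matchingD(1)[OF m xy(2,1)] by simp
      assume "E `` {u} = E `` {v}"
      then have "x = y" using pE[OF xy(1)] pE[OF xy(2)] by simp
      then show "u = v" using matchingD(2)[OF m xy] by blast
    qed
    moreover have "Domain P \<subseteq> L" using pE matchingD(3)[OF m] by (auto simp: L_def)
    ultimately show "Domain P \<in> {S. S \<subseteq> L \<and> good S}" by simp
    have "f \<in> auts V P" if f: "f \<in> auts V E" "f ` Domain P = Domain P" for f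
    proof -
      have "f u \<in> Domain P \<longleftrightarrow> u \<in> Domain P" for u
        using f(2) permutes_inj[OF autsD(1)[OF f(1)]] by (metis inj_image_mem_iff)
      then have "(f u, f v) \<in> E \<inter> Domain P \<times> UNIV \<longleftrightarrow> (u, v) \<in> E \<inter> Domain P \<times> UNIV" for u v
        using autsD(2)[OF f(1)] by auto
      then show ?thesis using autsD(1)[OF f(1)] unfolding P by (simp add: auts_def)
    qed
    then have "?A (Domain P) = auts V E \<inter> auts V P"
      using auts_image_Domain[of _ V P] by (intro equalityI subsetI) simp_all
    then show "?w (Domain P) = (\<Sum>f\<in>auts V E \<inter> auts V P. signed_weight (Domain P) f)" by simp
  next
    fix S assume "S \<in> {S. S \<subseteq> L \<and> good S}"
    then have S: "S \<subseteq> L" "good S" by auto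
    have Lnbr: "\<exists>t. (v, t) \<in> E" if "v \<in> S" for v
    proof -
      have "v \<in> L" using that S(1) by auto
      then show ?thesis by (auto simp: L_def)
    qed
    then show "Domain (E \<inter> S \<times> UNIV) = S" by blast
    have pE: "E `` {s} = {t}" if "(s, t) \<in> E" "s \<in> S" for s t
    proof -
      have "s \<in> L" using S(1) that(2) by auto
      then obtain t' where t': "E `` {s} = {t'}" by (auto simp: L_def)
      then have "t = t'" using that(1) by auto
      then show ?thesis using t' by simp
    qed
    then have p: "pendant E (E \<inter> S \<times> UNIV)" by (auto simp: pendant_def)
    have "matching V (E \<inter> S \<times> UNIV)"
      unfolding matching_def
    proof (intro conjI ballI, safe)
      fix a b assume "(a, b) \<in> E" then show "a \<in> V" "b \<in> V" using EV by auto
    next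
      fix a b c assume "(a, b) \<in> E" "a \<in> S" "(c, a) \<in> E" "c \<in> S"
      then show False using S(2) by (simp add: good_def)
    next
      fix s t t' assume "(s, t) \<in> E" "(s, t') \<in> E" "s \<in> S"
      then show "t = t'" using pE[of s t] pE[of s t'] by simp
    next
      fix s s' t assume *: "(s, t) \<in> E" "(s', t) \<in> E" "s \<in> S" "s' \<in> S"
      then have "E `` {s} = {t}" "E `` {s'} = {t}" using pE by auto
      then show "s = s'" using S(2) * unfolding good_def by simp
    qed
    with p show "E \<inter> S \<times> UNIV \<in> {P. matching V P \<and> pendant E P}" by simp
  qed
  also have "\<dots> = (\<Sum>S | S \<subseteq> L. ?w S)"
    using finL bad by (intro sum.mono_neutral_left) auto
  also have "\<dots> = (\<Sum>f\<in>auts V E. \<Sum>S | S \<subseteq> L \<and> f ` S = S. signed_weight S f)"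
    using finL finite_auts[OF V, of E] sum.swap_restrict[of "Pow L" "auts V E" "\<lambda>S f. signed_weight S f" "\<lambda>S f. f ` S = S"]
    by (simp add: Pow_def)
  also have "\<dots> = (\<Sum>f\<in>auts V E. if L = {} then 1 else 0)"
  proof (rule sum.cong[OF refl])
    fix f assume f: "f \<in> auts V E"
    have "f v \<in> L" if "v \<in> L" for v
    proof -
      obtain t where t: "E `` {v} = {t}" "v \<in> V" using \<open>v \<in> L\<close> by (auto simp: L_def)
      then have t': "(v, w) \<in> E \<longleftrightarrow> w = t" for w by auto
      have "E `` {f v} = {f t}"
      proof (intro set_eqI)
        fix w
        obtain w' where "w = f w'" using permutes_surj[OF autsD(1)[OF f]] by (metis surj_def)
        then show "w \<in> E `` {f v} \<longleftrightarrow> w \<in> {f t}"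
          using t'[of w'] autsD(2)[OF f] permutes_inj[OF autsD(1)[OF f]] by (auto dest: injD)
      qed
      then show ?thesis using t autsD(1)[OF f] by (auto simp: L_def permutes_in_image)
    qed
    then have "f ` L = L"
      using finL permutes_inj[OF autsD(1)[OF f]]
      by (intro endo_inj_surj) (auto intro: inj_on_subset)
    then show "(\<Sum>S | S \<subseteq> L \<and> f ` S = S. signed_weight S f) = (if L = {} then 1 else 0)"
      using finL autsD(1)[OF f] by (intro sum_signed_weight_invariant_subsets bij_betw_image_self) 
  qed
  finally have "(\<Sum>P | matching V P \<and> pendant E P. \<Sum>f\<in>auts V E \<inter> auts V P. signed_weight (Domain P) f)
      = (\<Sum>f\<in>auts V E. if L = {} then 1 else 0)" .
  also have "\<dots> = (if L = {} then int (card (auts V E)) else 0)" by simp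
  also have "\<dots> = (if \<exists>v\<in>V. \<exists>t. E `` {v} = {t} then 0 else int (card (auts V E)))"
    unfolding L_def by auto 
  finally show ?thesis .
qed

section \<open>Exchanging leaves for closed twins\<close>

text \<open>
  The retraction that moves each source of a matching to its target.
\<close>

definition contract :: "'a rel \<Rightarrow> 'a \<Rightarrow> 'a" where
  "contract P u = (if u \<in> Domain P then THE t. (u, t) \<in> P else u)"

lemma contract_matched:
  assumes "matching V P" "(s, t) \<in> P"
  shows "contract P s = t"
proof -
  have "(THE t. (s, t) \<in> P) = t"
    using assms(2) matchingD(2)[OF assms(1) _ assms(2)] by (intro the_equality) auto
  then show ?thesis using assms(2) by (auto simp: contract_def)
qed

lemma contract_notin: "u \<notin> Domain P \<Longrightarrow> contract P u = u"
  by (simp add: contract_def)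

lemma contract_cases:
  assumes "matching V P"
  obtains "(u, contract P u) \<in> P" | "u \<notin> Domain P" "contract P u = u"
proof (cases "u \<in> Domain P")
  case True
  then obtain t where "(u, t) \<in> P" by blast
  then show ?thesis using that(1) contract_matched[OF assms] by simp
next
  case False
  then show ?thesis using that(2) contract_notin by metis
qed

lemma contract_notin_Domain:
  assumes "matching V P"
  shows "contract P u \<notin> Domain P"
proof (cases rule: contract_cases[OF assms, of u])
  case 1
  then show ?thesis using matchingD(1)[OF assms _ 1] by blast
qed simp

lemma contract_aut:
  assumes "matching V P" "f \<in> auts V P"
  shows "contract P (f u) = f (contract P u)"
proof (cases "u \<in> Domain P")
  case True
  then obtain t where t: "(u, t) \<in> P" by blast
  then have "(f u, f t) \<in> P" using autsD(2)[OF assms(2)] by simp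
  then show ?thesis using t contract_matched[OF assms(1)] by simp
next
  case False
  have "f u \<in> f ` Domain P \<longleftrightarrow> u \<in> Domain P"
    by (rule inj_image_mem_iff[OF permutes_inj[OF autsD(1)[OF assms(2)]]])
  then have "f u \<notin> Domain P" using False by (simp only: auts_image_Domain[OF assms(2)]) simp
  then show ?thesis using False by (simp add: contract_notin)
qed

text \<open>
  If every source is a leaf at its target, then \<open>fuse P E\<close> makes every source a closed twin of its
  target: vertices are adjacent in the new graph iff their retracts are equal or adjacent. The inverse
  construction \<open>detach\<close> deletes all edges at the sources except those of the matching.
\<close>

definition fuse :: "'a rel \<Rightarrow> 'a rel \<Rightarrow> 'a rel" where
  "fuse P E = {(u, v). u \<noteq> v \<and> (contract P u, contract P v) \<in> E\<^sup>=}"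

definition detach :: "'a rel \<Rightarrow> 'a rel \<Rightarrow> 'a rel" where
  "detach P E = {(u, v) \<in> E. u \<notin> Domain P \<and> v \<notin> Domain P} \<union> P \<union> P\<inverse>"

lemma fuse_refl: "(u, v) \<in> (fuse P E)\<^sup>= \<longleftrightarrow> (contract P u, contract P v) \<in> E\<^sup>="
  by (auto simp: fuse_def)

lemma matching_subset: "matching V P \<Longrightarrow> P \<subseteq> V \<times> V"
  by (simp add: matching_def)

lemma contract_in:
  assumes "matching V P"
  shows "contract P u \<in> V \<longleftrightarrow> u \<in> V"
proof (cases rule: contract_cases[OF assms, of u])
  case 1
  then show ?thesis using matchingD(3,4)[OF assms 1 1] by simp
qed simp

lemma fuse_simple_graph:
  assumes "matching V P" "E \<in> simple_graphs V"
  shows "fuse P E \<in> simple_graphs V"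
proof -
  have sym: "(a, b) \<in> E \<Longrightarrow> (b, a) \<in> E" and EV: "(a, b) \<in> E \<Longrightarrow> a \<in> V \<and> b \<in> V" for a b
    using assms(2) by (auto simp: simple_graphs_def sym_def)
  have "u \<in> V \<and> v \<in> V" if "(u, v) \<in> fuse P E" for u v
  proof (cases "contract P u = contract P v")
    case True
    then show ?thesis using that assms(1) contract_cases[OF assms(1)] matchingD[OF assms(1)]
      by (smt (verit) case_prodD fuse_def mem_Collect_eq)
  next
    case False
    then have "(contract P u, contract P v) \<in> E" using that by (auto simp: fuse_def)
    then show ?thesis using EV contract_in[OF assms(1)] by metis
  qed
  moreover have "(v, u) \<in> fuse P E" if "(u, v) \<in> fuse P E" for u v
    using that sym by (auto simp: fuse_def)
  moreover have "(u, u) \<notin> fuse P E" for u by (simp add: fuse_def)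
  ultimately show ?thesis by (auto simp: simple_graphs_def sym_def irrefl_def)
qed

lemma fuse_twinned:
  assumes "matching V P"
  shows "twinned (fuse P E) P"
proof -
  have "closed_twins (fuse P E) s t" if "(s, t) \<in> P" for s t
  proof -
    have "t \<notin> Domain P" using contract_notin_Domain[OF assms, of s] contract_matched[OF assms that] by simp
    then show ?thesis
      unfolding closed_twins_def fuse_refl using contract_matched[OF assms that] by (simp add: contract_notin)
  qed
  then show ?thesis by (auto simp: twinned_def)
qed

lemma detach_simple_graph:
  assumes "matching V P" "E \<in> simple_graphs V"
  shows "detach P E \<in> simple_graphs V"
proof -
  have "(s, s) \<notin> P" for s using matchingD(1)[OF assms(1), of s s s s] by blast
  then show ?thesis
    using assms matching_subset[OF assms(1)] by (auto simp: simple_graphs_def sym_def irrefl_def detach_def)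
qed

lemma detach_pendant:
  assumes "matching V P"
  shows "pendant (detach P E) P"
proof -
  have "(s, w) \<in> detach P E \<longleftrightarrow> w = t" if st: "(s, t) \<in> P" for s t w
  proof -
    have "(s, w) \<in> P \<longleftrightarrow> w = t" using st matchingD(2)[OF assms st, of s w] by auto
    moreover have "(w, s) \<notin> P" using matchingD(1)[OF assms st, of w s] by auto
    ultimately show ?thesis using st by (auto simp: detach_def)
  qed
  then show ?thesis unfolding pendant_def by auto
qed

lemma detach_fuse:
  assumes m: "matching V P" and E: "E \<in> simple_graphs V" and p: "pendant E P"
  shows "detach P (fuse P E) = E"
proof -
  have sym: "(a, b) \<in> E \<Longrightarrow> (b, a) \<in> E" and irr: "(a, a) \<notin> E" for a b
    using E by (auto simp: simple_graphs_def sym_def irrefl_def)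
  have nbr: "(s, w) \<in> E \<longleftrightarrow> w = t" if "(s, t) \<in> P" for s t w
    using p that by (auto simp: pendant_def)
  have "(u, v) \<in> detach P (fuse P E) \<longleftrightarrow> (u, v) \<in> E" for u v
  proof -
    consider t where "(u, t) \<in> P" | t where "(v, t) \<in> P" | "u \<notin> Domain P" "v \<notin> Domain P" by blast
    then show ?thesis
    proof cases
      case 1
      have "(u, v) \<in> P \<longleftrightarrow> v = t" using 1 matchingD(2)[OF m 1, of u v] by auto
      moreover have "(v, u) \<notin> P" using matchingD(1)[OF m 1, of v u] by auto
      ultimately show ?thesis using nbr[OF 1, of v] 1 by (auto simp: detach_def)
    next
      case 2
      have "(v, u) \<in> P \<longleftrightarrow> u = t" using 2 matchingD(2)[OF m 2, of v u] by auto
      moreover have "(u, v) \<notin> P" using matchingD(1)[OF m 2, of u v] by auto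
      moreover have "(u, v) \<in> E \<longleftrightarrow> u = t" using nbr[OF 2, of u] sym by blast
      ultimately show ?thesis using 2 by (auto simp: detach_def)
    next
      case 3
      then have "(v, u) \<notin> P" "(u, v) \<notin> P" by auto
      then show ?thesis using 3 irr by (auto simp: detach_def fuse_def contract_notin)
    qed
  qed
  then show ?thesis by auto
qed

lemma fuse_detach:
  assumes m: "matching V P" and E: "E \<in> simple_graphs V" and p: "twinned E P"
  shows "fuse P (detach P E) = E"
proof -
  have sym: "(a, b) \<in> E\<^sup>= \<longleftrightarrow> (b, a) \<in> E\<^sup>=" and irr: "(a, a) \<notin> E" for a b
    using E by (auto simp: simple_graphs_def sym_def irrefl_def)
  have "closed_twins E u (contract P u)" for u
    using p by (cases rule: contract_cases[OF m, of u]) (auto simp: twinned_def closed_twins_def)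
  then have tw: "(u, w) \<in> E\<^sup>= \<longleftrightarrow> (contract P u, w) \<in> E\<^sup>=" for u w
    by (simp add: closed_twins_def)
  have "(u, v) \<in> fuse P (detach P E) \<longleftrightarrow> (u, v) \<in> E" for u v
  proof -
    have "(contract P u, contract P v) \<in> (detach P E)\<^sup>= \<longleftrightarrow> (contract P u, contract P v) \<in> E\<^sup>="
      using contract_notin_Domain[OF m] by (auto simp: detach_def)
    also have "\<dots> \<longleftrightarrow> (u, v) \<in> E\<^sup>=" using tw sym by metis
    finally show ?thesis using irr by (auto simp: fuse_def)
  qed
  then show ?thesis by auto
qed

lemma auts_fuse:
  assumes "matching V P" "f \<in> auts V P" "f \<in> auts V E"
  shows "f \<in> auts V (fuse P E)"
proof -
  have inj: "f u = f v \<longleftrightarrow> u = v" for u v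
    using permutes_inj[OF autsD(1)[OF assms(3)]] by (rule inj_eq)
  have "(f u, f v) \<in> fuse P E \<longleftrightarrow> (u, v) \<in> fuse P E" for u v
    by (simp add: fuse_def contract_aut[OF assms(1,2)] inj autsD(2)[OF assms(3)])
  then show ?thesis using autsD(1)[OF assms(3)] unfolding auts_def by blast
qed

lemma auts_detach:
  assumes "f \<in> auts V P" "f \<in> auts V E"
  shows "f \<in> auts V (detach P E)"
proof -
  have inj: "inj f" using autsD(1)[OF assms(1)] by (rule permutes_inj)
  have D: "f u \<in> Domain P \<longleftrightarrow> u \<in> Domain P" for u
  proof -
   have "f u \<in> f ` Domain P \<longleftrightarrow> u \<in> Domain P" using inj by (rule inj_image_mem_iff)
   then show ?thesis by (simp only: auts_image_Domain[OF assms(1)])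
  qed
  have "(f u, f v) \<in> detach P E \<longleftrightarrow> (u, v) \<in> detach P E" for u v
    using autsD(2)[OF assms(1), of u v]  autsD(2)[OF assms(1), of v u] autsD(2)[OF assms(2), of u v] D[of u] D[of v] unfolding detach_def by (simp only: Un_iff mem_Collect_eq case_prod_conv converse_iff)
  then show ?thesis using autsD(1)[OF assms(1)] unfolding auts_def by blast
qed

text \<open>
  Fusing adds only edges between vertices which are already joined by a path through targets. So it
  preserves connectedness, which is a property of the reachability relation.
\<close>

lemma rtrancl_fuse:
  assumes m: "matching V P" and E: "E \<in> simple_graphs V" and p: "pendant E P"
  shows "(fuse P E)\<^sup>* = E\<^sup>*"
proof (rule rtrancl_subset)
  have sym: "(a, b) \<in> E \<Longrightarrow> (b, a) \<in> E" for a b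
    using E by (auto simp: simple_graphs_def sym_def)
  have PE: "(s, t) \<in> E" if "(s, t) \<in> P" for s t using p that by (auto simp: pendant_def)
  have "(u, contract P u) \<in> E\<^sup>* \<and> (contract P u, u) \<in> E\<^sup>*" for u
  proof (cases rule: contract_cases[OF m, of u])
    case 1
    then show ?thesis using PE sym by blast
  qed simp
  then have c: "(u, contract P u) \<in> E\<^sup>*" "(contract P u, u) \<in> E\<^sup>*" for u by simp_all
  show "fuse P E \<subseteq> E\<^sup>*"
  proof (rule subrelI)
    fix u v assume "(u, v) \<in> fuse P E"
    then have "(contract P u, contract P v) \<in> E\<^sup>*" by (auto simp: fuse_def)
    then show "(u, v) \<in> E\<^sup>*" using c(1)[of u] c(2)[of v] by (meson rtrancl_trans)
  qed
  have PF: "(s, t) \<in> fuse P E" if "(s, t) \<in> P" for s t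
  proof -
    have "t \<notin> Domain P" "s \<noteq> t" using matchingD(1)[OF m _ that] that by blast+
    then show ?thesis using contract_matched[OF m that] by (simp add: fuse_def contract_notin)
  qed
  have "E = detach P (fuse P E)" by (rule detach_fuse[OF assms, symmetric])
  also have "\<dots> \<subseteq> fuse P E \<union> P \<union> P\<inverse>" by (auto simp: detach_def)
  also have "\<dots> \<subseteq> fuse P E"
    using PF symD[of "fuse P E"] fuse_simple_graph[OF m E] by (auto simp: simple_graphs_def)
  finally show "E \<subseteq> fuse P E" .
qed

text \<open>
  The predicate \<open>K\<close> is there to restrict the sums to connected graphs.
\<close>

lemma sum_pendant_eq_sum_twinned:
  assumes m: "matching V P"
  shows "(\<Sum>E | E \<in> simple_graphs V \<and> K (E\<^sup>*) \<and> pendant E P. \<Sum>f\<in>auts V E \<inter> auts V P. signed_weight (Domain P) f)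
       = (\<Sum>E | E \<in> simple_graphs V \<and> K (E\<^sup>*) \<and> twinned E P. \<Sum>f\<in>auts V E \<inter> auts V P. signed_weight (Domain P) f)"
proof (rule sum.reindex_bij_witness[of _ "detach P" "fuse P"])
  fix E assume "E \<in> {E. E \<in> simple_graphs V \<and> K (E\<^sup>*) \<and> pendant E P}"
  then have E: "E \<in> simple_graphs V" "K (E\<^sup>*)" "pendant E P" by auto
  show d: "detach P (fuse P E) = E" using detach_fuse[OF m E(1,3)] .
  show "fuse P E \<in> {E. E \<in> simple_graphs V \<and> K (E\<^sup>*) \<and> twinned E P}"
    using E fuse_simple_graph[OF m E(1)] fuse_twinned[OF m] rtrancl_fuse[OF m E(1,3)] by simp
  have "auts V (fuse P E) \<inter> auts V P = auts V E \<inter> auts V P"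
    using auts_fuse[OF m] auts_detach[of _ V P "fuse P E"] d by auto
  then show "(\<Sum>f\<in>auts V (fuse P E) \<inter> auts V P. signed_weight (Domain P) f) = (\<Sum>f\<in>auts V E \<inter> auts V P. signed_weight (Domain P) f)"
    by simp
next
  fix E assume "E \<in> {E. E \<in> simple_graphs V \<and> K (E\<^sup>*) \<and> twinned E P}"
  then have E: "E \<in> simple_graphs V" "K (E\<^sup>*)" "twinned E P" by auto
  show "fuse P (detach P E) = E" using fuse_detach[OF m E(1,3)] .
  then show "detach P E \<in> {E. E \<in> simple_graphs V \<and> K (E\<^sup>*) \<and> pendant E P}"
    using E detach_simple_graph[OF m E(1)] detach_pendant[OF m]
      rtrancl_fuse[OF m detach_simple_graph[OF m E(1)] detach_pendant[OF m]] by simp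
qed

section \<open>Classes of closed twins\<close>

lemma closed_twins_refl: "closed_twins E u u" by (simp add: closed_twins_def)
lemma closed_twins_sym: "closed_twins E u v \<Longrightarrow> closed_twins E v u" by (simp add: closed_twins_def)
lemma closed_twins_trans: "closed_twins E u v \<Longrightarrow> closed_twins E v w \<Longrightarrow> closed_twins E u w"
  by (simp add: closed_twins_def)

lemma closed_twins_in:
  assumes "E \<in> simple_graphs V" "closed_twins E u v" "u \<in> V"
  shows "v \<in> V"
proof -
  have "(v, u) \<in> E\<^sup>=" using assms(2) unfolding closed_twins_def by blast
  then show ?thesis using assms(1,3) by (auto simp: simple_graphs_def)
qed

lemma closed_twins_aut:
  assumes f: "f \<in> auts V E"
  shows "closed_twins E (f u) (f v) \<longleftrightarrow> closed_twins E u v"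
proof -
  have bij: "bij f" using autsD(1)[OF f] by (rule permutes_bij)
  have r: "(f a, f b) \<in> E\<^sup>= \<longleftrightarrow> (a, b) \<in> E\<^sup>=" for a b
    using autsD(2)[OF f] inj_eq[OF bij_is_inj[OF bij]] by simp
  have "(\<forall>w. (f u, w) \<in> E\<^sup>= \<longleftrightarrow> (f v, w) \<in> E\<^sup>=) \<longleftrightarrow> (\<forall>w. (f u, f w) \<in> E\<^sup>= \<longleftrightarrow> (f v, f w) \<in> E\<^sup>=)"
    using bij_is_surj[OF bij] by (metis surj_def)
  then show ?thesis unfolding closed_twins_def r .
qed

text \<open>
  Adjacency of distinct vertices depends only on their classes, so vertices may be permuted freely
  within each class.
\<close>

lemma class_preserving_aut:
  assumes E: "E \<in> simple_graphs V" and k: "k permutes V" and tw: "\<And>v. closed_twins E (k v) v"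
  shows "k \<in> auts V E"
proof -
  have sym: "(a, b) \<in> E\<^sup>= \<longleftrightarrow> (b, a) \<in> E\<^sup>=" and irr: "(a, a) \<notin> E" for a b
    using E by (auto simp: simple_graphs_def sym_def irrefl_def)
  have t: "(k a, b) \<in> E\<^sup>= \<longleftrightarrow> (a, b) \<in> E\<^sup>=" for a b
    using tw[of a] by (simp add: closed_twins_def)
  have "(k u, k v) \<in> E \<longleftrightarrow> (u, v) \<in> E" for u v
  proof -
    have "(k u, k v) \<in> E \<longleftrightarrow> (k u, k v) \<in> E\<^sup>= \<and> k u \<noteq> k v" using irr by auto
    also have "\<dots> \<longleftrightarrow> (u, v) \<in> E\<^sup>= \<and> u \<noteq> v"
      unfolding t inj_eq[OF permutes_inj[OF k]] sym[of u "k v"] t sym[of v u] ..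
    also have "\<dots> \<longleftrightarrow> (u, v) \<in> E" using irr by auto
    finally show ?thesis .
  qed
  then show ?thesis using k by (simp add: auts_def)
qed

text \<open>
  The smallest element of a twin class represents it; together with the second smallest element it
  forms the standard pair of the class.
\<close>

definition rep :: "'a::linorder rel \<Rightarrow> 'a \<Rightarrow> 'a" where
  "rep E v = Min {u. closed_twins E v u}"

definition second :: "'a::linorder rel \<Rightarrow> 'a \<Rightarrow> 'a" where
  "second E v = Min ({u. closed_twins E v u} - {rep E v})"

text \<open>
  The representatives of the classes with at least two elements.
\<close>

definition twin_reps :: "'a::linorder set \<Rightarrow> 'a rel \<Rightarrow> 'a set" where
  "twin_reps V E = {rep E v |v. v \<in> V \<and> (\<exists>u. u \<noteq> v \<and> closed_twins E v u)}"

context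
  fixes V :: "'a::linorder set" and E :: "'a rel"
  assumes V: "finite V" and E: "E \<in> simple_graphs V"
begin

lemma finite_twin_class: "v \<in> V \<Longrightarrow> finite {u. closed_twins E v u}"
  using closed_twins_in[OF E] V by (metis finite_subset mem_Collect_eq subsetI)

lemma rep_twin: "v \<in> V \<Longrightarrow> closed_twins E v (rep E v)"
  using Min_in[OF finite_twin_class, of v] closed_twins_refl[of E v] unfolding rep_def by blast

lemma rep_in: "v \<in> V \<Longrightarrow> rep E v \<in> V"
  using closed_twins_in[OF E rep_twin] by blast

lemma twin_class_eq: "closed_twins E u v \<Longrightarrow> {w. closed_twins E u w} = {w. closed_twins E v w}"
  by (simp add: closed_twins_def)

lemma rep_eq_iff:
  assumes "u \<in> V" "v \<in> V"
  shows "rep E u = rep E v \<longleftrightarrow> closed_twins E u v"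
proof
  assume "rep E u = rep E v"
  then show "closed_twins E u v"
    using rep_twin[OF assms(1)] rep_twin[OF assms(2)] by (metis closed_twins_sym closed_twins_trans)
next
  assume "closed_twins E u v"
  then show "rep E u = rep E v" unfolding rep_def by (simp only: twin_class_eq)
qed

lemma rep_rep: "v \<in> V \<Longrightarrow> rep E (rep E v) = rep E v"
  using rep_eq_iff rep_in rep_twin closed_twins_sym by metis

lemma second_cong:
  assumes "closed_twins E u v"
  shows "second E u = second E v"
  unfolding second_def rep_def by (simp only: twin_class_eq[OF assms])

lemma second_twin:
  assumes "v \<in> V" "u \<noteq> v" "closed_twins E v u"
  shows "closed_twins E v (second E v)" "second E v \<noteq> rep E v"
proof -
  have "{u. closed_twins E v u} - {rep E v} \<noteq> {}"
  proof (cases "rep E v = v")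
    case True
    then show ?thesis using assms by auto
  next
    case False
    then show ?thesis using closed_twins_refl[of E v] by auto
  qed
  then have "second E v \<in> {u. closed_twins E v u} - {rep E v}"
    unfolding second_def by (intro Min_in) (simp_all add: finite_twin_class assms)
  then show "closed_twins E v (second E v)" "second E v \<noteq> rep E v" by auto
qed

lemma twin_repsD:
  assumes "s \<in> twin_reps V E"
  shows "s \<in> V" "rep E s = s" "closed_twins E s (second E s)" "second E s \<noteq> s"
proof -
  obtain v u where v: "v \<in> V" "s = rep E v" "u \<noteq> v" "closed_twins E v u"
    using assms unfolding twin_reps_def by blast
  show s: "s \<in> V" "rep E s = s" using v rep_in rep_rep by auto
  have vs: "closed_twins E v s" using rep_twin v by blast
  have "\<exists>w. w \<noteq> s \<and> closed_twins E s w"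
    using v vs by (metis closed_twins_sym closed_twins_trans)
  then obtain w where "w \<noteq> s" "closed_twins E s w" by blast
  then show "closed_twins E s (second E s)" "second E s \<noteq> s"
    using second_twin[OF s(1)] s(2) by auto
qed

lemma twin_repsI: "v \<in> V \<Longrightarrow> u \<noteq> v \<Longrightarrow> closed_twins E v u \<Longrightarrow> rep E v \<in> twin_reps V E"
  unfolding twin_reps_def by blast

lemma finite_twin_reps: "finite (twin_reps V E)"
  using twin_repsD(1) V by (meson finite_subset subsetI)

text \<open>
  This is the action of \<open>f\<close> on the twin classes, transported to representatives.
\<close>

lemma bij_betw_rep_aut:
  assumes f: "f \<in> auts V E"
  shows "bij_betw (rep E \<circ> f) (twin_reps V E) (twin_reps V E)"
proof -
  let ?A = "twin_reps V E"
  have fV: "f v \<in> V" if "v \<in> V" for v using that permutes_in_image[OF autsD(1)[OF f]] by simp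
  have "(rep E \<circ> f) s \<in> ?A" if s: "s \<in> ?A" for s
  proof -
    have "closed_twins E (f s) (f (second E s))" using twin_repsD(3)[OF s] closed_twins_aut[OF f] by blast
    moreover have "f (second E s) \<noteq> f s"
      using twin_repsD(4)[OF s] inj_eq[OF permutes_inj[OF autsD(1)[OF f]]] by simp
    ultimately show ?thesis using twin_repsI fV twin_repsD(1)[OF s] by simp
  qed
  moreover have inj: "inj_on (rep E \<circ> f) ?A"
  proof (rule inj_onI)
    fix s t assume st: "s \<in> ?A" "t \<in> ?A" "(rep E \<circ> f) s = (rep E \<circ> f) t"
    then have "closed_twins E (f s) (f t)" using rep_eq_iff fV twin_repsD(1) by simp
    then have "closed_twins E s t" using closed_twins_aut[OF f] by blast
    then show "s = t" using rep_eq_iff twin_repsD(1,2) st(1,2) by metis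
  qed
  ultimately have "(rep E \<circ> f) ` ?A = ?A"
    using finite_twin_reps by (intro endo_inj_surj) auto
  then show ?thesis using inj by (simp add: bij_betw_def)
qed

section \<open>Matchings of closed twins\<close>

text \<open>
  Distinct pairs of a twinned matching with this property lie in distinct twin classes.
\<close>

definition one_per_class :: "'a rel \<Rightarrow> bool" where
  "one_per_class P \<longleftrightarrow> (\<forall>(s, t) \<in> P. \<forall>(s', t') \<in> P. closed_twins E s s' \<longrightarrow> s = s')"

text \<open>
  Within a single class there is a permutation that moves a given pair to the standard pair. As the
  pairs lie in distinct classes, these permutations combine to one permutation of all vertices, and its
  inverse is as required.
\<close>

lemma exists_standardizing_perm:
  assumes m: "matching V P" and tw: "twinned E P" and sc: "one_per_class P"
  shows "\<exists>k. k permutes V \<and> (\<forall>v. closed_twins E (k v) v)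
     \<and> (\<forall>(s, t) \<in> P. k (rep E s) = s \<and> k (second E s) = t)"
proof -
  have twP: "closed_twins E s t" if "(s, t) \<in> P" for s t using tw that by (auto simp: twinned_def)
  have V1: "s \<in> V" "t \<in> V" "s \<noteq> t" if "(s, t) \<in> P" for s t using matchingD[OF m that that] by auto
  have sec: "closed_twins E s (second E s)" "second E s \<noteq> rep E s" if "(s, t) \<in> P" for s t
    using second_twin[OF V1(1)[OF that] V1(3)[OF that, symmetric] twP[OF that]] by auto
  \<comment> \<open>the inner transposition sends \<open>s\<close> to the representative, the outer one corrects the image of \<open>t\<close>
    without moving the representative\<close>
  define q where "q s t = transpose (transpose s (rep E s) t) (second E s) \<circ> transpose s (rep E s)" for s t
  have qs: "q s t s = rep E s" "q s t t = second E s" if "(s, t) \<in> P" for s t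
  proof -
    have "transpose s (rep E s) t \<noteq> rep E s"
      using V1(3)[OF that] by (auto simp: transpose_def split: if_splits)
    then show "q s t s = rep E s" using sec(2)[OF that] by (simp add: q_def transpose_def)
    show "q s t t = second E s" by (simp add: q_def)
  qed
  have injq: "inj (q s t)" for s t unfolding q_def by (intro inj_compose) (auto intro: bij_is_inj)
  define C where "C s = {u. closed_twins E s u}" for s
  have qC: "q s t v \<in> C s" if "(s, t) \<in> P" "v \<in> C s" for s t v
  proof -
    have "{s, t, rep E s, second E s} \<subseteq> C s"
      using twP[OF that(1)] sec(1)[OF that(1)] rep_twin[OF V1(1)[OF that(1)]] closed_twins_refl[of E s]
      by (auto simp: C_def)
    then show ?thesis using that(2) by (auto simp: q_def transpose_def)
  qed
  define k where "k v = (if \<exists>(s, t) \<in> P. v \<in> C s then (let (s, t) = (SOME p. p \<in> P \<and> v \<in> C (fst p)) in q s t v) else v)" for v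
  have kq: "k v = q s t v" if "(s, t) \<in> P" "v \<in> C s" for s t v
  proof -
    have "p = (s, t)" if p: "p \<in> P \<and> v \<in> C (fst p)" for p
    proof -
      obtain s' t' where p': "p = (s', t')" by (cases p)
      then have "closed_twins E s' s" using p \<open>v \<in> C s\<close> unfolding C_def
        by (metis closed_twins_sym closed_twins_trans fst_conv mem_Collect_eq)
      then have "s' = s" using sc p p' \<open>(s, t) \<in> P\<close> unfolding one_per_class_def by blast
      then show ?thesis using p p' matchingD(2)[OF m \<open>(s, t) \<in> P\<close>, of s' t'] by simp
    qed
    then have "(SOME p. p \<in> P \<and> v \<in> C (fst p)) = (s, t)" using that by (intro some_equality) auto
    then show ?thesis using that unfolding k_def by auto
  qed
  have kid: "k v = v" if "\<And>s t. (s, t) \<in> P \<Longrightarrow> v \<notin> C s" for v using that unfolding k_def by auto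
  have ktw: "closed_twins E (k v) v" for v
  proof (cases "\<exists>s t. (s, t) \<in> P \<and> v \<in> C s")
    case True
    then obtain s t where st: "(s, t) \<in> P" "v \<in> C s" by blast
    then have "k v \<in> C s" using qC kq by simp
    then show ?thesis using st(2) unfolding C_def by (metis closed_twins_sym closed_twins_trans mem_Collect_eq)
  next
    case False
    then show ?thesis using kid closed_twins_refl by metis
  qed
  have CV: "u \<in> V" if "(s, t) \<in> P" "u \<in> C s" for s t u
    using closed_twins_in[OF E _ V1(1)[OF that(1)]] that(2) by (simp add: C_def)
  have "inj_on k V"
  proof (rule inj_onI)
    fix u v assume uv: "k u = k v"
    have c: "closed_twins E u v" using ktw[of u] ktw[of v] uv by (metis closed_twins_sym closed_twins_trans)
    show "u = v"
    proof (cases "\<exists>s t. (s, t) \<in> P \<and> v \<in> C s")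
      case True
      then obtain s t where st: "(s, t) \<in> P" "v \<in> C s" by blast
      then have "u \<in> C s" using c unfolding C_def by (metis closed_twins_sym closed_twins_trans mem_Collect_eq)
      then show ?thesis using kq st uv injD[OF injq] by metis
    next
      case False
      then have "\<And>s t. (s, t) \<in> P \<Longrightarrow> u \<notin> C s" using c unfolding C_def by (metis closed_twins_trans mem_Collect_eq)
      then show ?thesis using False kid uv by metis
    qed
  qed
  moreover have "k ` V \<subseteq> V" using closed_twins_in[OF E closed_twins_sym[OF ktw]] by auto
  ultimately have "bij_betw k V V" using V by (simp add: bij_betw_def endo_inj_surj)
  moreover have "k v = v" if "v \<notin> V" for v using kid CV that by blast
  ultimately have kp: "k permutes V" by (rule bij_imp_permutes)
  show ?thesis
  proof (intro exI[of _ "inv k"] conjI allI ballI)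
    show "inv k permutes V" using kp by (rule permutes_inv)
    show "closed_twins E (inv k v) v" for v
      using ktw[of "inv k v"] permutes_inverses(1)[OF kp] closed_twins_sym by metis
    fix p assume p: "p \<in> P"
    obtain s t where st: "p = (s, t)" by (cases p)
    then have "s \<in> C s" "t \<in> C s" "(s, t) \<in> P" using p twP[of s t] closed_twins_refl[of E s] by (simp_all add: C_def)
    then have "k s = rep E s" "k t = second E s" using kq[of s t] qs[of s t] by simp_all
    then have "inv k (rep E s) = s" "inv k (second E s) = t"
      using permutes_inverses(2)[OF kp, of s] permutes_inverses(2)[OF kp, of t] by simp_all
    then show "case p of (s, t) \<Rightarrow> inv k (rep E s) = s \<and> inv k (second E s) = t"
      using st by simp
  qed
qed

text \<open>
  Two pairs \<open>(s, t)\<close> and \<open>(s', t')\<close> in one class can be exchanged by an automorphism, which acts on the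
  sources as the transposition of \<open>s\<close> and \<open>s'\<close> and so reverses the sign.
\<close>

lemma sum_auts_not_one_per_class:
  assumes m: "matching V P" and tw: "twinned E P" and ns: "\<not> one_per_class P"
  shows "(\<Sum>f\<in>auts V E \<inter> auts V P. signed_weight (Domain P) f) = 0"
proof -
  obtain s t s' t' where P: "(s, t) \<in> P" "(s', t') \<in> P" and c: "closed_twins E s s'" and ne: "s \<noteq> s'"
    using ns unfolding one_per_class_def by blast
  have ne': "t \<noteq> t'" "s \<noteq> t" "s \<noteq> t'" "s' \<noteq> t" "s' \<noteq> t'"
    using matchingD[OF m P] matchingD[OF m P(2,1)] matchingD[OF m P(1,1)] matchingD[OF m P(2,2)] ne by auto
  have sV: "s \<in> V" "s' \<in> V" "t \<in> V" "t' \<in> V" using matchingD[OF m P] matchingD[OF m P(2,1)] by auto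
  have tws: "closed_twins E s t" "closed_twins E s' t'" using tw P by (auto simp: twinned_def)
  let ?g = "transpose s s' \<circ> transpose t t'"
  have gp: "?g permutes V" using sV by (intro permutes_compose permutes_swap_id)
  have "closed_twins E (?g v) v" for v
  proof -
    have "closed_twins E t t'" using c tws by (metis closed_twins_sym closed_twins_trans)
    then show ?thesis using c closed_twins_sym closed_twins_refl ne'
      by (auto simp: transpose_def)
  qed
  then have gE: "?g \<in> auts V E" by (rule class_preserving_aut[OF E gp])
  have gx: "?g x = (if x = s then s' else if x = s' then s else if x = t then t' else if x = t' then t else x)" for x
    using ne ne' by (simp add: transpose_def)
  have "finite P" using m V unfolding matching_def by (meson finite_SigmaI finite_subset)
  have gP: "?g \<in> auts V P"
  proof (rule autsI_finite[OF gp \<open>finite P\<close>])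
    fix u v assume uv: "(u, v) \<in> P"
    have u: "u = s \<longleftrightarrow> v = t" "u = s' \<longleftrightarrow> v = t'" "u \<noteq> t" "u \<noteq> t'" "v \<noteq> s" "v \<noteq> s'"
      using matchingD[OF m uv P(1)] matchingD[OF m uv P(2)]
        matchingD[OF m P(1) uv] matchingD[OF m P(2) uv] by auto
    show "(?g u, ?g v) \<in> P" unfolding gx using u P uv ne ne' by auto
  qed
  have D: "x \<in> Domain P \<Longrightarrow> ?g x = transpose s s' x" for x
  proof -
    assume "x \<in> Domain P"
    then obtain y where "(x, y) \<in> P" by blast
    then have "x \<noteq> t" "x \<noteq> t'" using matchingD(1)[OF m _ P(1)] matchingD(1)[OF m _ P(2)] by auto
    then show ?thesis by simp
  qed
  have gg: "?g (?g x) = x" for x unfolding gx using ne ne' by auto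
  show ?thesis
  proof (rule sum_eq_0_if_sign_reversing[where i = "\<lambda>f. ?g \<circ> f"])
    show "finite (auts V E \<inter> auts V P)" using finite_auts[OF V] by blast
    fix f assume f: "f \<in> auts V E \<inter> auts V P"
    have "bij_betw f (Domain P) (Domain P)"
      using f by (intro bij_betw_image_self[of f V] auts_image_Domain[of f V]) (auto dest: autsD(1))
    then have "signed_weight (Domain P) (?g \<circ> f) = - signed_weight (Domain P) f"
      using P ne D finite_Domain[OF \<open>finite P\<close>] by (intro signed_weight_transpose[of _ _ s s']) auto
    moreover have "?g \<circ> f \<in> auts V E \<inter> auts V P" using f gE gP auts_comp[of ?g V E f] auts_comp[of ?g V P f] by blast
    moreover have "?g \<circ> (?g \<circ> f) = f"
    proof
      fix x show "(?g \<circ> (?g \<circ> f)) x = f x" using gg[of "f x"] by simp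
    qed
    ultimately show "?g \<circ> f \<in> auts V E \<inter> auts V P \<and> ?g \<circ> (?g \<circ> f) = f \<and> signed_weight (Domain P) (?g \<circ> f) = - signed_weight (Domain P) f"
      by blast
  qed
qed

text \<open>
  A fixed choice is needed: the same permutation has to be multiplied to \<open>f\<close> and later cancelled.
\<close>

definition standardizer :: "'a rel \<Rightarrow> 'a \<Rightarrow> 'a" where
  "standardizer P = (SOME k. k permutes V \<and> (\<forall>v. closed_twins E (k v) v)
     \<and> (\<forall>(s, t) \<in> P. k (rep E s) = s \<and> k (second E s) = t))"

lemma standardizer:
  assumes "matching V P" "twinned E P" "one_per_class P"
  shows "standardizer P permutes V" "closed_twins E (standardizer P v) v"
    "(s, t) \<in> P \<Longrightarrow> standardizer P (rep E s) = s" "(s, t) \<in> P \<Longrightarrow> standardizer P (second E s) = t"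
    "standardizer P \<in> auts V E"
proof -
  have *: "standardizer P permutes V \<and> (\<forall>v. closed_twins E (standardizer P v) v)
     \<and> (\<forall>(s, t) \<in> P. standardizer P (rep E s) = s \<and> standardizer P (second E s) = t)"
    unfolding standardizer_def by (rule someI_ex[OF exists_standardizing_perm[OF assms]])
  then show 1: "standardizer P permutes V" "closed_twins E (standardizer P v) v" for v by blast+
  show "(s, t) \<in> P \<Longrightarrow> standardizer P (rep E s) = s" "(s, t) \<in> P \<Longrightarrow> standardizer P (second E s) = t"
    using * by auto
  show "standardizer P \<in> auts V E" using 1 by (rule class_preserving_aut[OF E])
qed

text \<open>
  The image under \<open>g\<close> of the standard pairs of the classes represented in \<open>S\<close>.
\<close>

definition push_matching :: "'a set \<Rightarrow> ('a \<Rightarrow> 'a) \<Rightarrow> 'a rel" where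
  "push_matching S g = (\<lambda>s. (g s, g (second E s))) ` S"

lemma push_matching_props:
  assumes S: "S \<subseteq> twin_reps V E" and g: "g \<in> auts V E"
  shows "matching V (push_matching S g)" "twinned E (push_matching S g)" "one_per_class (push_matching S g)"
proof -
  have sV: "s \<in> V" "rep E s = s" "closed_twins E s (second E s)" "second E s \<noteq> s" "second E s \<in> V"
    if "s \<in> S" for s
    using twin_repsD[of s] closed_twins_in[OF E, of s "second E s"] S that by auto
  have gV: "g v \<in> V" if "v \<in> V" for v using that permutes_in_image[OF autsD(1)[OF g]] by simp
  have inj: "g u = g v \<longleftrightarrow> u = v" for u v using permutes_inj[OF autsD(1)[OF g]] by (rule inj_eq)
  have eqS: "s = s'" if "s \<in> S" "s' \<in> S" "closed_twins E s s'" for s s'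
    using that sV rep_eq_iff by metis
  have "second E s \<noteq> s'" if "s \<in> S" "s' \<in> S" for s s'
    using sV[OF that(1)] sV[OF that(2)] eqS[OF that] by metis
  moreover have "second E s = second E s' \<longleftrightarrow> s = s'" if "s \<in> S" "s' \<in> S" for s s'
    using sV[OF that(1)] sV[OF that(2)] eqS[OF that] closed_twins_sym closed_twins_trans by metis
  moreover have "push_matching S g \<subseteq> V \<times> V" using sV gV by (auto simp: push_matching_def)
  ultimately show "matching V (push_matching S g)"
    unfolding matching_def push_matching_def by (auto simp: inj)
  show "twinned E (push_matching S g)"
    using sV(3) closed_twins_aut[OF g] by (auto simp: twinned_def push_matching_def)
  show "one_per_class (push_matching S g)"
    using eqS closed_twins_aut[OF g] unfolding one_per_class_def push_matching_def by auto
qed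

lemma rep_image_push_matching:
  "rep E ` Domain (push_matching S g) = (rep E \<circ> g) ` S"
  unfolding push_matching_def Domain_fst image_image by simp

lemma push_standardizer:
  assumes "matching V P" "twinned E P" "one_per_class P" and f: "f \<in> auts V P"
  shows "push_matching (rep E ` Domain P) (f \<circ> standardizer P) = P"
proof -
  have k: "standardizer P (rep E s) = s" "standardizer P (second E (rep E s)) = t" if "(s, t) \<in> P" for s t
  proof -
    have "s \<in> V" using matchingD(3)[OF assms(1) that that] .
    then have "second E (rep E s) = second E s" using second_cong[OF rep_twin] by simp
    then show "standardizer P (rep E s) = s" "standardizer P (second E (rep E s)) = t"
      using standardizer(3,4)[OF assms(1-3) that] by simp_all
  qed
  have "push_matching (rep E ` Domain P) (f \<circ> standardizer P) = map_prod f f ` P"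
  proof (intro set_eqI iffI)
    fix x assume "x \<in> push_matching (rep E ` Domain P) (f \<circ> standardizer P)"
    then obtain s t where st: "(s, t) \<in> P"
      "x = (f (standardizer P (rep E s)), f (standardizer P (second E (rep E s))))"
      unfolding push_matching_def by auto
    then have "x = map_prod f f (s, t)" using k[OF st(1)] by simp
    then show "x \<in> map_prod f f ` P" using st(1) by blast
  next
    fix x assume "x \<in> map_prod f f ` P"
    then obtain s t where st: "(s, t) \<in> P" "x = (f s, f t)" by auto
    then have "x = (\<lambda>s. ((f \<circ> standardizer P) s, (f \<circ> standardizer P) (second E s))) (rep E s)"
      using k[OF st(1)] by simp
    then show "x \<in> push_matching (rep E ` Domain P) (f \<circ> standardizer P)"
      unfolding push_matching_def using st(1) by blast
  qed
  also have "\<dots> = P"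
  proof (intro set_eqI iffI)
    fix x assume "x \<in> map_prod f f ` P"
    then show "x \<in> P" using autsD(2)[OF f] by auto
  next
    fix x assume x: "x \<in> P"
    have i: "f (inv f v) = v" for v using permutes_inverses(1)[OF autsD(1)[OF f]] .
    obtain u v where uv: "x = (u, v)" by (cases x)
    then have "(inv f u, inv f v) \<in> P" using x autsD(2)[OF f, of "inv f u" "inv f v"] i by simp
    moreover have "x = map_prod f f (inv f u, inv f v)" using uv i by simp
    ultimately show "x \<in> map_prod f f ` P" by blast
  qed
  finally show ?thesis .
qed

text \<open>
  The automorphisms \<open>g\<close> that send the standard pairs of the classes of \<open>P\<close> onto \<open>P\<close> are the
  products of an automorphism \<open>f\<close> of both \<open>E\<close> and \<open>P\<close> with the standardizing permutation of \<open>P\<close>.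
  Conversely \<open>P\<close> is recovered from \<open>g\<close> and the set of classes as the image of the standard pairs,
  and then so is \<open>f\<close>. As the standardizing permutation acts trivially on the classes, \<open>f\<close> acts on
  the sources of \<open>P\<close> as \<open>g\<close> acts on their classes, and the weights agree.
\<close>

lemma sum_one_per_class_matchings:
  "(\<Sum>(P, f) \<in> {(P, f). matching V P \<and> twinned E P \<and> one_per_class P \<and> f \<in> auts V E \<inter> auts V P}. signed_weight (Domain P) f)
   = (\<Sum>(S, g) \<in> {(S, g). S \<subseteq> twin_reps V E \<and> g \<in> auts V E \<and> (rep E \<circ> g) ` S = S}. signed_weight S (rep E \<circ> g))"
  (is "sum ?w ?X = sum ?w' ?Y")
proof (rule sum.reindex_bij_witness[of _
    "\<lambda>(S, g). (push_matching S g, g \<circ> inv (standardizer (push_matching S g)))"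
    "\<lambda>(P, f). (rep E ` Domain P, f \<circ> standardizer P)"])
  fix x assume "x \<in> ?X"
  then obtain P f where x: "x = (P, f)" and P: "matching V P" "twinned E P" "one_per_class P"
    and f: "f \<in> auts V E" "f \<in> auts V P" by auto
  let ?k = "standardizer P"
  note k = standardizer[OF P]
  have push: "push_matching (rep E ` Domain P) (f \<circ> ?k) = P" using P f(2) by (rule push_standardizer)
  have "f \<circ> ?k \<circ> inv ?k = f"
    by (simp add: fun_eq_iff permutes_inverses(1)[OF k(1)])
  then show "(\<lambda>(S, g). (push_matching S g, g \<circ> inv (standardizer (push_matching S g))))
      ((\<lambda>(P, f). (rep E ` Domain P, f \<circ> standardizer P)) x) = x"
    using push x by simp
  have DV: "s \<in> V" if "s \<in> Domain P" for s using that matchingD(3)[OF P(1)] by blast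
  have conj: "(rep E \<circ> (f \<circ> ?k)) (rep E s) = rep E (f s)" if "s \<in> Domain P" for s
    using that k(3) by auto
  have fD: "f ` Domain P = Domain P" using f(2) by (rule auts_image_Domain)
  have "rep E ` Domain P \<subseteq> twin_reps V E"
  proof
    fix r assume "r \<in> rep E ` Domain P"
    then obtain s t where st: "(s, t) \<in> P" "r = rep E s" by blast
    then show "r \<in> twin_reps V E"
      using twin_repsI[of s t] matchingD[OF P(1) st(1) st(1)] P(2) unfolding twinned_def by blast
  qed
  moreover have "f \<circ> ?k \<in> auts V E" using f(1) k(5) by (rule auts_comp)
  moreover have "(rep E \<circ> (f \<circ> ?k)) ` (rep E ` Domain P) = rep E ` Domain P"
  proof -
    have "(rep E \<circ> (f \<circ> ?k)) ` (rep E ` Domain P) = (\<lambda>s. rep E (f s)) ` Domain P"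
      unfolding image_image by (rule image_cong[OF refl conj])
    also have "\<dots> = rep E ` (f ` Domain P)" by (simp only: image_image)
    finally show ?thesis unfolding fD .
  qed
  ultimately show "(\<lambda>(P, f). (rep E ` Domain P, f \<circ> standardizer P)) x \<in> ?Y" using x by simp
  have "finite (Domain P)" using DV V by (meson finite_subset subsetI)
  moreover have "bij_betw f (Domain P) (Domain P)"
    using autsD(1)[OF f(1)] fD by (rule bij_betw_image_self)
  moreover have "inj_on (rep E) (Domain P)"
    using P(3) DV rep_eq_iff unfolding inj_on_def one_per_class_def by blast
  ultimately have "signed_weight (rep E ` Domain P) (rep E \<circ> (f \<circ> ?k)) = signed_weight (Domain P) f"
    by (rule signed_weight_conj) (rule conj)
  then show "?w' ((\<lambda>(P, f). (rep E ` Domain P, f \<circ> standardizer P)) x) = ?w x" using x by simp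
next
  fix y assume "y \<in> ?Y"
  then obtain S g where y: "y = (S, g)" and S: "S \<subseteq> twin_reps V E" and g: "g \<in> auts V E"
    and gS: "(rep E \<circ> g) ` S = S" by auto
  define P where "P = push_matching S g"
  note P = push_matching_props[OF S g, folded P_def]
  let ?k = "standardizer P"
  note k = standardizer[OF P]
  have repP: "rep E ` Domain P = S" unfolding P_def rep_image_push_matching by (rule gS)
  have inv_k: "inv ?k \<in> auts V E" using k(5) by (rule auts_inv)
  have "g \<circ> inv ?k \<circ> ?k = g" by (simp add: fun_eq_iff permutes_inverses(2)[OF k(1)])
  then show "(\<lambda>(P, f). (rep E ` Domain P, f \<circ> standardizer P))
     ((\<lambda>(S, g). (push_matching S g, g \<circ> inv (standardizer (push_matching S g)))) y) = y"
    using y repP by (simp add: P_def[symmetric])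
  have gk: "g \<circ> inv ?k \<in> auts V E" using g inv_k by (rule auts_comp)
  have "g \<circ> inv ?k \<in> auts V P"
  proof (rule autsI_finite)
    show "g \<circ> inv ?k permutes V" using gk by (rule autsD)
    show "finite P" using P(1) V unfolding matching_def by (meson finite_SigmaI finite_subset)
    fix s t assume st: "(s, t) \<in> P"
    have sV: "s \<in> V" using matchingD(3)[OF P(1) st st] .
    have "inv ?k s = rep E s" "inv ?k t = second E s"
      using k(3,4)[OF st] permutes_inverses(2)[OF k(1)] by metis+
    moreover have "rep E s \<in> S" using repP st by blast
    moreover have "second E s = second E (rep E s)" using second_cong[OF rep_twin[OF sV]] .
    ultimately show "((g \<circ> inv ?k) s, (g \<circ> inv ?k) t) \<in> P"
      unfolding P_def push_matching_def by auto
  qed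
  then show "(\<lambda>(S, g). (push_matching S g, g \<circ> inv (standardizer (push_matching S g)))) y \<in> ?X"
    using y P gk by (simp add: P_def[symmetric])
qed

lemma finite_matchings: "finite {P. matching V P \<and> Q P}"
  using V by (intro finite_subset[of "{P. matching V P \<and> Q P}" "Pow (V \<times> V)"]) (auto simp: matching_def)

text \<open>
  Once matchings are replaced by sets of classes, the summation over these sets for a fixed
  automorphism is inclusion-exclusion for its action on the classes with at least two elements.
\<close>

lemma sum_twinned_matchings:
  "(\<Sum>P | matching V P \<and> twinned E P. \<Sum>f\<in>auts V E \<inter> auts V P. signed_weight (Domain P) f)
   = (if twin_reps V E = {} then int (card (auts V E)) else 0)"
proof -
  let ?A = "twin_reps V E"
  have "(\<Sum>P | matching V P \<and> twinned E P. \<Sum>f\<in>auts V E \<inter> auts V P. signed_weight (Domain P) f)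
     = (\<Sum>P | matching V P \<and> twinned E P \<and> one_per_class P. \<Sum>f\<in>auts V E \<inter> auts V P. signed_weight (Domain P) f)"
    using sum_auts_not_one_per_class finite_matchings by (intro sum.mono_neutral_right) auto
  also have "\<dots> = (\<Sum>(P, f) \<in> (SIGMA P:{P. matching V P \<and> twinned E P \<and> one_per_class P}. auts V E \<inter> auts V P). signed_weight (Domain P) f)"
    using finite_matchings finite_auts[OF V] by (intro sum.Sigma) auto
  also have "\<dots> = (\<Sum>(S, g) \<in> {(S, g). S \<subseteq> ?A \<and> g \<in> auts V E \<and> (rep E \<circ> g) ` S = S}. signed_weight S (rep E \<circ> g))"
    unfolding sum_one_per_class_matchings[symmetric] by (rule sum.cong) auto
  also have "\<dots> = (\<Sum>(g, S) \<in> (SIGMA g:auts V E. {S. S \<subseteq> ?A \<and> (rep E \<circ> g) ` S = S}). signed_weight S (rep E \<circ> g))"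
    by (rule sum.reindex_bij_witness[of _ prod.swap prod.swap]) auto
  also have "\<dots> = (\<Sum>g\<in>auts V E. \<Sum>S | S \<subseteq> ?A \<and> (rep E \<circ> g) ` S = S. signed_weight S (rep E \<circ> g))"
    using finite_twin_reps finite_auts[OF V] by (intro sum.Sigma[symmetric]) auto
  also have "\<dots> = (\<Sum>g\<in>auts V E. if ?A = {} then 1 else 0)"
    by (intro sum.cong[OF refl] sum_signed_weight_invariant_subsets finite_twin_reps bij_betw_rep_aut)
  also have "\<dots> = (if ?A = {} then int (card (auts V E)) else 0)" by simp
  finally show ?thesis .
qed

lemma twin_reps_empty_iff:
  "twin_reps V E = {} \<longleftrightarrow> (\<forall>u\<in>V. \<forall>v\<in>V. u \<noteq> v \<longrightarrow> \<not> closed_twins E u v)"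
proof
  assume "twin_reps V E = {}"
  then show "\<forall>u\<in>V. \<forall>v\<in>V. u \<noteq> v \<longrightarrow> \<not> closed_twins E u v"
    using twin_repsI by (metis empty_iff)
next
  assume *: "\<forall>u\<in>V. \<forall>v\<in>V. u \<noteq> v \<longrightarrow> \<not> closed_twins E u v"
  have "s \<notin> twin_reps V E" for s
    using * twin_repsD[of s] closed_twins_in[OF E, of s "second E s"] by metis
  then show "twin_reps V E = {}" by blast
qed
end

section \<open>Leafless graphs and twin-free graphs\<close>

text \<open>
  Both sides equal the signed sum over matchings, taken graph by graph; in between, the order of
  summation is changed so that leaves can be exchanged for twins with the matching held fixed.
\<close>

theorem sum_card_auts_leafless_eq_twinfree:
  fixes V :: "'a::linorder set"
  assumes V: "finite V"
  shows "(\<Sum>E | E \<in> simple_graphs V \<and> K (E\<^sup>*) \<and> \<not> (\<exists>v\<in>V. \<exists>t. E `` {v} = {t}). card (auts V E))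
       = (\<Sum>E | E \<in> simple_graphs V \<and> K (E\<^sup>*) \<and> (\<forall>u\<in>V. \<forall>v\<in>V. u \<noteq> v \<longrightarrow> \<not> closed_twins E u v). card (auts V E))"
proof -
  define G where "G = {E. E \<in> simple_graphs V \<and> K (E\<^sup>*)}"
  let ?M = "{P. matching V P}"
  let ?w = "\<lambda>E P. \<Sum>f\<in>auts V E \<inter> auts V P. signed_weight (Domain P) f"
  have finM: "finite ?M" by (rule finite_subset[of _ "Pow (V \<times> V)"]) (auto simp: matching_def V)
  have finG: "finite G" by (rule finite_subset[of _ "Pow (V \<times> V)"]) (auto simp: G_def simple_graphs_def V)
  have swap: "(\<Sum>E\<in>G. \<Sum>P | matching V P \<and> Q E P. ?w E P) = (\<Sum>P\<in>?M. \<Sum>E | E \<in> G \<and> Q E P. ?w E P)"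
    for Q :: "'a rel \<Rightarrow> 'a rel \<Rightarrow> bool"
    using sum.swap_restrict[OF finG finM, of ?w Q] by simp
  have "int (\<Sum>E | E \<in> G \<and> \<not> (\<exists>v\<in>V. \<exists>t. E `` {v} = {t}). card (auts V E))
      = (\<Sum>E\<in>G. if \<exists>v\<in>V. \<exists>t. E `` {v} = {t} then 0 else int (card (auts V E)))"
    using finG unfolding of_nat_sum by (intro sum.mono_neutral_cong_left) auto
  also have "\<dots> = (\<Sum>E\<in>G. \<Sum>P | matching V P \<and> pendant E P. ?w E P)"
    using V by (intro sum.cong[OF refl] sum_pendant_matchings[symmetric]) (simp_all add: G_def)
  also have "\<dots> = (\<Sum>P\<in>?M. \<Sum>E | E \<in> G \<and> pendant E P. ?w E P)" by (rule swap)
  also have "\<dots> = (\<Sum>P\<in>?M. \<Sum>E | E \<in> G \<and> twinned E P. ?w E P)"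
    using sum_pendant_eq_sum_twinned[of V _ K] by (intro sum.cong[OF refl]) (simp add: G_def conj_assoc)
  also have "\<dots> = (\<Sum>E\<in>G. \<Sum>P | matching V P \<and> twinned E P. ?w E P)" by (rule swap[symmetric])
  also have "\<dots> = (\<Sum>E\<in>G. if twin_reps V E = {} then int (card (auts V E)) else 0)"
    using V by (intro sum.cong[OF refl] sum_twinned_matchings) (simp_all add: G_def)
  also have "\<dots> = (\<Sum>E\<in>G. if \<forall>u\<in>V. \<forall>v\<in>V. u \<noteq> v \<longrightarrow> \<not> closed_twins E u v then int (card (auts V E)) else 0)"
  proof (rule sum.cong[OF refl])
    fix E assume "E \<in> G"
    then have "E \<in> simple_graphs V" by (simp add: G_def)
    then show "(if twin_reps V E = {} then int (card (auts V E)) else 0)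
      = (if \<forall>u\<in>V. \<forall>v\<in>V. u \<noteq> v \<longrightarrow> \<not> closed_twins E u v then int (card (auts V E)) else 0)"
      by (simp only: twin_reps_empty_iff[OF V])
  qed
  also have "\<dots> = int (\<Sum>E | E \<in> G \<and> (\<forall>u\<in>V. \<forall>v\<in>V. u \<noteq> v \<longrightarrow> \<not> closed_twins E u v). card (auts V E))"
    using finG unfolding of_nat_sum by (intro sum.mono_neutral_cong_right) auto
  finally show ?thesis unfolding G_def of_nat_eq_iff by (simp only: mem_Collect_eq conj_assoc)
qed

section \<open>Counting isomorphism classes by automorphisms\<close>

definition standard_graph :: "nat \<Rightarrow> nat rel \<Rightarrow> nat pair_pre_digraph" where
  "standard_graph n E = \<lparr>pverts = {..<n}, parcs = E\<rparr>"

lemma standard_graph_simps [simp]: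
  "pverts (standard_graph n E) = {..<n}" "parcs (standard_graph n E) = E"
  by (simp_all add: standard_graph_def)

lemma pair_graph_iff:
  "pair_graph G \<longleftrightarrow> finite (pverts G) \<and> parcs G \<in> simple_graphs (pverts G)"
proof
  assume "pair_graph G"
  then interpret pair_graph G .
  have loop: "(a, a) \<notin> parcs G" for a using no_loops'[of a a] by blast
  show "finite (pverts G) \<and> parcs G \<in> simple_graphs (pverts G)"
    using in_arcsD1 in_arcsD2 loop arcs_symmetric
    by (auto simp: simple_graphs_def sym_def irrefl_def)
next
  assume G: "finite (pverts G) \<and> parcs G \<in> simple_graphs (pverts G)"
  then have "finite (parcs G)" by (auto simp: simple_graphs_def intro: finite_subset)
  then show "pair_graph G"
    using G by unfold_locales (auto simp: simple_graphs_def symmetric_def irrefl_def)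
qed

lemma graph_iso_standard_graph:
  assumes "(standard_graph n E, standard_graph n E') \<in> graph_iso"
  shows "\<exists>g. g permutes {..<n} \<and> (\<forall>u v. (g u, g v) \<in> E' \<longleftrightarrow> (u, v) \<in> E)"
proof -
  obtain h where h: "bij_betw h {..<n} {..<n}"
    and e: "\<And>u v. u < n \<Longrightarrow> v < n \<Longrightarrow> (u, v) \<in> E \<longleftrightarrow> (h u, h v) \<in> E'"
    and sg: "E \<in> simple_graphs {..<n}" "E' \<in> simple_graphs {..<n}"
    using assms unfolding graph_iso_iff pair_graph_iff by auto
  define g where "g = restrict_id h {..<n}"
  have g: "g permutes {..<n}" unfolding g_def using h by (rule permutes_restrict_id)
  have "(g u, g v) \<in> E' \<longleftrightarrow> (u, v) \<in> E" for u v
  proof (cases "u < n \<and> v < n")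
    case True
    then show ?thesis using e by (simp add: g_def restrict_id_def)
  next
    case False
    then have "\<not> (g u < n \<and> g v < n)" using permutes_in_image[OF g] by (metis lessThan_iff)
    then show ?thesis using False sg unfolding simple_graphs_def by blast
  qed
  with g show ?thesis by blast
qed

lemma graph_iso_permuted:
  assumes "g permutes {..<n}" and e: "\<And>u v. (g u, g v) \<in> E' \<longleftrightarrow> (u, v) \<in> E"
    and "E \<in> simple_graphs {..<n}" "E' \<in> simple_graphs {..<n}"
  shows "(standard_graph n E, standard_graph n E') \<in> graph_iso"
  unfolding graph_iso_iff pair_graph_iff
  using assms permutes_imp_bij[OF assms(1)] by (auto intro!: exI[of _ g])

text \<open>
  This is the orbit-stabilizer theorem, proved by counting pairs. With a fixed isomorphism \<open>\<tau> E\<close> from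
  \<open>E0\<close> to each isomorphic graph \<open>E\<close>, every permutation \<open>g\<close> of the vertices is uniquely \<open>f \<circ> \<tau> E\<close>, where
  \<open>E\<close> is the image of \<open>E0\<close> under \<open>g\<close> and \<open>f\<close> is an automorphism of \<open>E\<close>.
\<close>

lemma sum_card_auts_iso_class:
  assumes E0: "E0 \<in> simple_graphs {..<n}"
  shows "(\<Sum>E | E \<in> simple_graphs {..<n} \<and> (standard_graph n E0, standard_graph n E) \<in> graph_iso.
            card (auts {..<n} E)) = fact n"
proof -
  define X where "X = {E. E \<in> simple_graphs {..<n} \<and> (standard_graph n E0, standard_graph n E) \<in> graph_iso}"
  have finX: "finite X"
    by (rule finite_subset[of _ "Pow ({..<n} \<times> {..<n})"]) (auto simp: X_def simple_graphs_def)
  have "\<forall>E\<in>X. \<exists>g. g permutes {..<n} \<and> (\<forall>u v. (g u, g v) \<in> E \<longleftrightarrow> (u, v) \<in> E0)"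
    unfolding X_def by (auto intro: graph_iso_standard_graph)
  then obtain \<tau> where \<tau>: "\<tau> E permutes {..<n}" "(\<tau> E u, \<tau> E v) \<in> E \<longleftrightarrow> (u, v) \<in> E0" if "E \<in> X" for E u v
    by (metis (no_types))
  let ?move = "\<lambda>g. map_prod g g ` E0"
  have mem: "(g u, g v) \<in> ?move g \<longleftrightarrow> (u, v) \<in> E0" if "g permutes {..<n}" for g u v
    using permutes_inj[OF that] by (auto dest: injD)
  have moveX: "?move g \<in> X" if g: "g permutes {..<n}" for g
  proof -
    have "?move g \<in> simple_graphs {..<n}"
      using E0 permutes_in_image[OF g] permutes_inj[OF g]
      unfolding simple_graphs_def sym_def irrefl_def by (fastforce dest: injD)
    then show ?thesis using graph_iso_permuted[OF g mem[OF g] E0] by (simp add: X_def)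
  qed
  have "bij_betw (\<lambda>(E, f). f \<circ> \<tau> E) (SIGMA E:X. auts {..<n} E) {g. g permutes {..<n}}"
  proof (rule bij_betw_byWitness[where f' = "\<lambda>g. (?move g, g \<circ> inv (\<tau> (?move g)))"])
    have mv: "?move (f \<circ> \<tau> E) = E" if "E \<in> X" "f \<in> auts {..<n} E" for E f
    proof -
      have p: "f \<circ> \<tau> E permutes {..<n}" using \<tau>(1) autsD(1) that by (intro permutes_compose) auto
      have "(a, b) \<in> ?move (f \<circ> \<tau> E) \<longleftrightarrow> (a, b) \<in> E" for a b
      proof -
        obtain u v where uv: "a = (f \<circ> \<tau> E) u" "b = (f \<circ> \<tau> E) v"
          using permutes_surj[OF p] by (metis surj_def)
        show ?thesis unfolding uv mem[OF p] using \<tau>(2)[OF that(1)] autsD(2)[OF that(2)] by simp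
      qed
      then show ?thesis by auto
    qed
    show "\<forall>a\<in>SIGMA E:X. auts {..<n} E. (\<lambda>g. (?move g, g \<circ> inv (\<tau> (?move g)))) ((\<lambda>(E, f). f \<circ> \<tau> E) a) = a"
    proof
      fix a assume "a \<in> (SIGMA E:X. auts {..<n} E)"
      then obtain E f where a: "a = (E, f)" "E \<in> X" "f \<in> auts {..<n} E" by auto
      have "f \<circ> \<tau> E \<circ> inv (\<tau> E) = f"
        by (simp add: fun_eq_iff permutes_inverses(1)[OF \<tau>(1)[OF a(2)]])
      then show "(\<lambda>g. (?move g, g \<circ> inv (\<tau> (?move g)))) ((\<lambda>(E, f). f \<circ> \<tau> E) a) = a"
        unfolding a(1) prod.case mv[OF a(2,3)] by simp
    qed
    show "\<forall>g\<in>{g. g permutes {..<n}}. (\<lambda>(E, f). f \<circ> \<tau> E) (?move g, g \<circ> inv (\<tau> (?move g))) = g"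
    proof
      fix g assume "g \<in> {g. g permutes {..<n}}"
      then have "?move g \<in> X" using moveX by blast
      from permutes_inverses(2)[OF \<tau>(1)[OF this]]
      show "(\<lambda>(E, f). f \<circ> \<tau> E) (?move g, g \<circ> inv (\<tau> (?move g))) = g" by (simp add: fun_eq_iff)
    qed
    show "(\<lambda>(E, f). f \<circ> \<tau> E) ` (SIGMA E:X. auts {..<n} E) \<subseteq> {g. g permutes {..<n}}"
      using \<tau>(1) autsD(1) by (auto intro!: permutes_compose)
    show "(\<lambda>g. (?move g, g \<circ> inv (\<tau> (?move g)))) ` {g. g permutes {..<n}} \<subseteq> (SIGMA E:X. auts {..<n} E)"
    proof
      fix a assume "a \<in> (\<lambda>g. (?move g, g \<circ> inv (\<tau> (?move g)))) ` {g. g permutes {..<n}}"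
      then obtain g where g: "g permutes {..<n}" and a: "a = (?move g, g \<circ> inv (\<tau> (?move g)))" by blast
      note t = \<tau>[OF moveX[OF g]]
      have "((g \<circ> inv (\<tau> (?move g))) u, (g \<circ> inv (\<tau> (?move g))) v) \<in> ?move g \<longleftrightarrow> (u, v) \<in> ?move g" for u v
        using t(2)[of "inv (\<tau> (?move g)) u" "inv (\<tau> (?move g)) v"] mem[OF g]
        unfolding o_apply permutes_inverses(1)[OF t(1)] by simp
      moreover have "g \<circ> inv (\<tau> (?move g)) permutes {..<n}"
        using g t(1) by (intro permutes_compose permutes_inv)
      ultimately show "a \<in> (SIGMA E:X. auts {..<n} E)"
        unfolding a auts_def using moveX[OF g] by blast
    qed
  qed
  then have "card (SIGMA E:X. auts {..<n} E) = card {g. g permutes {..<n}}" by (rule bij_betw_same_card)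
  also have "\<dots> = fact n" by (rule card_permutations) simp_all
  finally show ?thesis using finX finite_auts[of "{..<n}"] by (simp add: card_SigmaI X_def)
qed

lemma card_unlabeled_structures:
  assumes F: "F \<subseteq> {G. pair_graph G}" and iso: "\<And>G H. G \<in> F \<Longrightarrow> (G, H) \<in> graph_iso \<Longrightarrow> H \<in> F"
  shows "card (unlabeled_structures F n) * fact n
    = (\<Sum>E | E \<in> simple_graphs {..<n} \<and> standard_graph n E \<in> F. card (auts {..<n} E))"
proof -
  define A where "A = {E. E \<in> simple_graphs {..<n} \<and> standard_graph n E \<in> F}"
  have finA: "finite A"
    by (rule finite_subset[of _ "Pow ({..<n} \<times> {..<n})"]) (auto simp: A_def simple_graphs_def)
  define cls where "cls E = graph_iso `` {standard_graph n E}" for E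
  have pg: "pair_graph (standard_graph n E)" if "E \<in> simple_graphs {..<n}" for E
    using that by (simp add: pair_graph_iff)
  have cls_eq: "cls E = cls E' \<longleftrightarrow> (standard_graph n E, standard_graph n E') \<in> graph_iso"
    if "E \<in> simple_graphs {..<n}" "E' \<in> simple_graphs {..<n}" for E E'
    unfolding cls_def using pg that by (intro eq_equiv_class_iff[OF equiv_graph_iso]) auto
  have img: "cls ` A = unlabeled_structures F n"
  proof
    show "cls ` A \<subseteq> unlabeled_structures F n"
      by (auto simp: A_def cls_def unlabeled_structures_def intro!: quotientI)
    show "unlabeled_structures F n \<subseteq> cls ` A"
    proof
      fix C assume "C \<in> unlabeled_structures F n"
      then obtain G where G: "G \<in> F" "card (pverts G) = n" and C: "C = graph_iso `` {G}"
        by (auto simp: unlabeled_structures_def quotient_def)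
      have pG: "pair_graph G" using F G(1) by blast
      then have fin: "finite (pverts G)" and sg: "parcs G \<in> simple_graphs (pverts G)"
        by (simp_all add: pair_graph_iff)
      obtain h where h: "bij_betw h (pverts G) {..<n}"
        using ex_bij_betw_finite_nat[OF fin] G(2) by (auto simp: atLeast0LessThan)
      define E where "E = map_prod h h ` parcs G"
      have hv: "h u < n" if "u \<in> pverts G" for u using bij_betwE[OF h] that by auto
      have inj: "h u = h v \<longleftrightarrow> u = v" if "u \<in> pverts G" "v \<in> pverts G" for u v
        using h that by (auto simp: bij_betw_def dest: inj_onD)
      have arc: "u \<in> pverts G \<and> v \<in> pverts G \<and> u \<noteq> v \<and> (v, u) \<in> parcs G" if "(u, v) \<in> parcs G" for u v
        using sg that by (auto simp: simple_graphs_def sym_def irrefl_def)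
      have "E \<subseteq> {..<n} \<times> {..<n}" using arc hv by (auto simp: E_def)
      moreover have "sym E" using arc by (force simp: E_def sym_def)
      moreover have "irrefl E" using arc inj by (auto simp: E_def irrefl_def)
      ultimately have E: "E \<in> simple_graphs {..<n}" by (simp add: simple_graphs_def)
      have "(u, v) \<in> parcs G \<longleftrightarrow> (h u, h v) \<in> E" if uv: "u \<in> pverts G" "v \<in> pverts G" for u v
        using arc inj uv by (auto simp: E_def)
      then have GE: "(G, standard_graph n E) \<in> graph_iso"
        unfolding graph_iso_iff using pG pg[OF E] h by auto
      then have "standard_graph n E \<in> F" using iso G(1) by blast
      moreover have "C = cls E" unfolding C cls_def using GE by (rule equiv_class_eq[OF equiv_graph_iso])
      ultimately show "C \<in> cls ` A" using E by (simp add: A_def)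
    qed
  qed
  have "(\<Sum>E\<in>A. card (auts {..<n} E)) = (\<Sum>C\<in>cls ` A. \<Sum>E | E \<in> A \<and> cls E = C. card (auts {..<n} E))"
    using finA by (rule sum.image_gen)
  also have "\<dots> = (\<Sum>C\<in>cls ` A. fact n)"
  proof (rule sum.cong[OF refl])
    fix C assume "C \<in> cls ` A"
    then obtain E0 where E0: "E0 \<in> A" "C = cls E0" by blast
    then have sg: "E0 \<in> simple_graphs {..<n}" "standard_graph n E0 \<in> F" by (auto simp: A_def)
    have "{E. E \<in> A \<and> cls E = C} = {E. E \<in> simple_graphs {..<n} \<and> (standard_graph n E0, standard_graph n E) \<in> graph_iso}"
      unfolding E0(2) A_def using cls_eq[OF sg(1)] iso[OF sg(2)] by auto
    then show "(\<Sum>E | E \<in> A \<and> cls E = C. card (auts {..<n} E)) = fact n"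
      using sum_card_auts_iso_class[OF sg(1)] by simp
  qed
  finally have "(\<Sum>E\<in>A. card (auts {..<n} E)) = card (unlabeled_structures F n) * fact n" by (simp add: img)
  then show ?thesis by (simp add: A_def)
qed

lemma type_gen_series_eqI:
  assumes F: "F \<subseteq> {G. pair_graph G}" "\<And>G H. G \<in> F \<Longrightarrow> (G, H) \<in> graph_iso \<Longrightarrow> H \<in> F"
    and F': "F' \<subseteq> {G. pair_graph G}" "\<And>G H. G \<in> F' \<Longrightarrow> (G, H) \<in> graph_iso \<Longrightarrow> H \<in> F'"
    and eq: "\<And>n. (\<Sum>E | E \<in> simple_graphs {..<n} \<and> standard_graph n E \<in> F. card (auts {..<n} E))
      = (\<Sum>E | E \<in> simple_graphs {..<n} \<and> standard_graph n E \<in> F'. card (auts {..<n} E))"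
  shows "type_gen_series F = type_gen_series F'"
proof -
  have "card (unlabeled_structures F n) = card (unlabeled_structures F' n)" for n
  proof -
    have "card (unlabeled_structures F n) * fact n
      = (\<Sum>E | E \<in> simple_graphs {..<n} \<and> standard_graph n E \<in> F. card (auts {..<n} E))"
      using F by (rule card_unlabeled_structures)
    also note eq
    also have "(\<Sum>E | E \<in> simple_graphs {..<n} \<and> standard_graph n E \<in> F'. card (auts {..<n} E))
      = card (unlabeled_structures F' n) * fact n"
      using F' by (rule card_unlabeled_structures[symmetric])
    finally show ?thesis by simp
  qed
  then show ?thesis by (simp add: type_gen_series_def)
qed

section \<open>The four classes of graphs\<close>

lemma connected_graph_iff:
  assumes "pair_graph G"
  shows "connected_graph G \<longleftrightarrow> pverts G \<noteq> {} \<and> (\<forall>u\<in>pverts G. \<forall>v\<in>pverts G. (u, v) \<in> (parcs G)\<^sup>*)"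
proof -
  interpret pair_graph G by (rule assms)
  have "u \<rightarrow>\<^sup>*\<^bsub>mk_symmetric (with_proj G)\<^esub> v \<longleftrightarrow> (u, v) \<in> (parcs G)\<^sup>*" if "u \<in> pverts G" for u v
    using reachable_mk_symmetric_eq[OF sym_arcs] reachable_conv'[of u v] that by simp
  then show ?thesis
    unfolding connected_graph_def Digraph_Component.connected_def strongly_connected_def by simp
qed

lemma without_endpoints_iff:
  "without_endpoints G \<longleftrightarrow> \<not> (\<exists>v\<in>pverts G. \<exists>t. parcs G `` {v} = {t})"
proof -
  have "out_degree (with_proj G) v = card (parcs G `` {v})" for v
  proof -
    have "out_arcs (with_proj G) v = Pair v ` (parcs G `` {v})"
      by (auto simp: out_arcs_def image_iff)
    then show ?thesis by (simp add: out_degree_def card_image inj_on_def)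
  qed
  then show ?thesis by (simp add: without_endpoints_def card_1_singleton_iff)
qed

text \<open>
  Neighborhoods in the complement are the complements of closed neighborhoods.
\<close>

lemma co_point_determining_iff:
  assumes "pair_graph G"
  shows "co_point_determining G \<longleftrightarrow> (\<forall>u\<in>pverts G. \<forall>v\<in>pverts G. u \<noteq> v \<longrightarrow> \<not> closed_twins (parcs G) u v)"
proof -
  have EV: "parcs G \<subseteq> pverts G \<times> pverts G" using assms by (simp add: pair_graph_iff simple_graphs_def)
  have nb: "neighborhood (graph_complement G) u = pverts G - (parcs G)\<^sup>= `` {u}" if "u \<in> pverts G" for u
    using that by (auto simp: neighborhood_def graph_complement_def)
  have "neighborhood (graph_complement G) u = neighborhood (graph_complement G) v \<longleftrightarrow> closed_twins (parcs G) u v"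
    if uv: "u \<in> pverts G" "v \<in> pverts G" for u v
  proof -
    have s: "(parcs G)\<^sup>= `` {u} \<subseteq> pverts G" "(parcs G)\<^sup>= `` {v} \<subseteq> pverts G" using EV uv by auto
    have "neighborhood (graph_complement G) u = neighborhood (graph_complement G) v \<longleftrightarrow>
      (parcs G)\<^sup>= `` {u} = (parcs G)\<^sup>= `` {v}"
      unfolding nb[OF uv(1)] nb[OF uv(2)] using s by (metis double_diff subset_refl)
    also have "\<dots> \<longleftrightarrow> closed_twins (parcs G) u v"
      unfolding closed_twins_def set_eq_iff Image_singleton_iff ..
    finally show ?thesis .
  qed
  moreover have "pverts (graph_complement G) = pverts G" by (simp add: graph_complement_def)
  ultimately show ?thesis by (simp add: co_point_determining_def point_determining_def)
qed

lemma graph_isoE: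
  assumes "(G, H) \<in> graph_iso"
  obtains h where "parcs G \<in> simple_graphs (pverts G)" "pair_graph G" "pair_graph H"
    "inj_on h (pverts G)" "pverts H = h ` pverts G" "parcs H = map_prod h h ` parcs G"
proof -
  obtain h where pg: "pair_graph G" "pair_graph H" and h: "bij_betw h (pverts G) (pverts H)"
    and e: "\<And>u v. u \<in> pverts G \<Longrightarrow> v \<in> pverts G \<Longrightarrow> (u, v) \<in> parcs G \<longleftrightarrow> (h u, h v) \<in> parcs H"
    using assms unfolding graph_iso_iff by blast
  have sg: "parcs G \<in> simple_graphs (pverts G)" and sH: "parcs H \<subseteq> pverts H \<times> pverts H"
    using pg by (simp_all add: pair_graph_iff simple_graphs_def)
  have pv: "pverts H = h ` pverts G" using h by (simp add: bij_betw_def)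
  have "parcs H = map_prod h h ` parcs G"
  proof (intro set_eqI iffI)
    fix x assume x: "x \<in> parcs H"
    then obtain u v where "x = (h u, h v)" "u \<in> pverts G" "v \<in> pverts G" using sH pv by auto
    then have "(u, v) \<in> parcs G" "x = map_prod h h (u, v)" using e x by auto
    then show "x \<in> map_prod h h ` parcs G" by blast
  next
    fix x assume "x \<in> map_prod h h ` parcs G"
    then obtain u v where "(u, v) \<in> parcs G" "x = (h u, h v)" by auto
    then show "x \<in> parcs H" using e sg by (auto simp: simple_graphs_def)
  qed
  then show ?thesis using that sg pg h pv by (simp add: bij_betw_def)
qed

lemma connected_graph_iso:
  assumes iso: "(G, H) \<in> graph_iso" and c: "connected_graph G"
  shows "connected_graph H"
proof -
  obtain h where h: "pair_graph G" "pair_graph H" "pverts H = h ` pverts G" "parcs H = map_prod h h ` parcs G"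
    using graph_isoE[OF iso] by metis
  have "(h u, h v) \<in> (parcs H)\<^sup>*" if "(u, v) \<in> (parcs G)\<^sup>*" for u v
    using that
  proof (induction rule: rtrancl_induct)
    case (step y z)
    then have "(h y, h z) \<in> parcs H" unfolding h(4) by force
    then show ?case using step.IH by (rule rtrancl_into_rtrancl[rotated])
  qed simp
  then show ?thesis using c h(3) unfolding connected_graph_iff[OF h(1)] connected_graph_iff[OF h(2)] by auto
qed

lemma without_endpoints_iso:
  assumes iso: "(G, H) \<in> graph_iso" and w: "without_endpoints G"
  shows "without_endpoints H"
  unfolding without_endpoints_iff
proof
  obtain h where h: "parcs G \<in> simple_graphs (pverts G)" "inj_on h (pverts G)"
      "pverts H = h ` pverts G" "parcs H = map_prod h h ` parcs G"
    using graph_isoE[OF iso] by metis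
  have EV: "u \<in> pverts G \<and> v \<in> pverts G" if "(u, v) \<in> parcs G" for u v
    using h(1) that by (auto simp: simple_graphs_def)
  assume "\<exists>v\<in>pverts H. \<exists>t. parcs H `` {v} = {t}"
  then obtain v t' where v: "v \<in> pverts G" "parcs H `` {h v} = {t'}" using h(3) by auto
  have "parcs H `` {h v} = h ` (parcs G `` {v})"
    unfolding h(4) using EV v(1) h(2) by (auto simp: image_iff Bex_def dest: inj_onD)
  then have "h ` (parcs G `` {v}) = {t'}" using v(2) by metis
  then have "card (h ` (parcs G `` {v})) = 1" by simp
  moreover have "inj_on h (parcs G `` {v})" using h(2) EV by (auto intro: inj_on_subset)
  ultimately have "card (parcs G `` {v}) = 1" by (simp add: card_image)
  then show False using w v(1) unfolding without_endpoints_iff by (auto simp: card_1_singleton_iff)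
qed

lemma co_point_determining_iso:
  assumes iso: "(G, H) \<in> graph_iso" and c: "co_point_determining G"
  shows "co_point_determining H"
proof -
  obtain h where h: "pair_graph G" "pair_graph H" "parcs G \<in> simple_graphs (pverts G)" "inj_on h (pverts G)"
      "pverts H = h ` pverts G" "parcs H = map_prod h h ` parcs G"
    using graph_isoE[OF iso] by metis
  have EV: "u \<in> pverts G \<and> v \<in> pverts G" if "(u, v) \<in> parcs G" for u v
    using h(3) that by (auto simp: simple_graphs_def)
  have e: "(h u, h v) \<in> (parcs H)\<^sup>= \<longleftrightarrow> (u, v) \<in> (parcs G)\<^sup>=" if "u \<in> pverts G" "v \<in> pverts G" for u v
  proof -
    have inj: "h x = h y \<longleftrightarrow> x = y" if "x \<in> pverts G" "y \<in> pverts G" for x y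
      using h(4) that by (rule inj_on_eq_iff)
    have "(h u, h v) \<in> parcs H \<longleftrightarrow> (u, v) \<in> parcs G"
    proof
      assume "(h u, h v) \<in> parcs H"
      then obtain x y where xy: "(x, y) \<in> parcs G" "h u = h x" "h v = h y" unfolding h(6) by auto
      then show "(u, v) \<in> parcs G" using EV[OF xy(1)] inj that by simp
    qed (force simp: h(6))
    then show ?thesis using inj that by simp
  qed
  have "closed_twins (parcs G) u v"
    if uv: "u \<in> pverts G" "v \<in> pverts G" and t: "closed_twins (parcs H) (h u) (h v)" for u v
    unfolding closed_twins_def
  proof
    fix w show "(u, w) \<in> (parcs G)\<^sup>= \<longleftrightarrow> (v, w) \<in> (parcs G)\<^sup>="
    proof (cases "w \<in> pverts G")
      case True
      then show ?thesis using t e[OF uv(1) True] e[OF uv(2) True] by (simp add: closed_twins_def)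
    next
      case False
      then show ?thesis using EV uv by auto
    qed
  qed
  note tw = this
  show ?thesis
    unfolding co_point_determining_iff[OF h(2)]
  proof (intro ballI impI notI)
    fix x y assume xy: "x \<in> pverts H" "y \<in> pverts H" "x \<noteq> y" "closed_twins (parcs H) x y"
    then obtain u v where uv: "u \<in> pverts G" "v \<in> pverts G" "x = h u" "y = h v" using h(5) by auto
    then have "closed_twins (parcs G) u v" "u \<noteq> v" using tw xy by auto
    then show False using c uv(1,2) unfolding co_point_determining_iff[OF h(1)] by blast
  qed
qed

theorem corollary3p2:
  shows "type_gen_series \<M> = type_gen_series \<Q> \<and>
         type_gen_series \<M>c = type_gen_series \<Q>c"
proof
  have pg: "pair_graph (standard_graph n E)" if "E \<in> simple_graphs {..<n}" for n E
    using that by (simp add: pair_graph_iff)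
  have pg': "pair_graph H" if "(G, H) \<in> graph_iso" for G H using that by (simp add: graph_iso_def)
  note iff = connected_graph_iff[OF pg] without_endpoints_iff co_point_determining_iff[OF pg]
  show "type_gen_series \<M> = type_gen_series \<Q>"
  proof (rule type_gen_series_eqI)
    fix n
    have "{E. E \<in> simple_graphs {..<n} \<and> standard_graph n E \<in> \<M>} =
      {E. E \<in> simple_graphs {..<n} \<and> True \<and> \<not> (\<exists>v\<in>{..<n}. \<exists>t. E `` {v} = {t})}"
      using pg by (auto simp: \<M>_def iff)
    moreover have "{E. E \<in> simple_graphs {..<n} \<and> standard_graph n E \<in> \<Q>} =
      {E. E \<in> simple_graphs {..<n} \<and> True \<and> (\<forall>u\<in>{..<n}. \<forall>v\<in>{..<n}. u \<noteq> v \<longrightarrow> \<not> closed_twins E u v)}"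
      using pg by (auto simp: \<Q>_def iff)
    ultimately show "(\<Sum>E | E \<in> simple_graphs {..<n} \<and> standard_graph n E \<in> \<M>. card (auts {..<n} E))
        = (\<Sum>E | E \<in> simple_graphs {..<n} \<and> standard_graph n E \<in> \<Q>. card (auts {..<n} E))"
      using sum_card_auts_leafless_eq_twinfree[of "{..<n}" "\<lambda>_. True"] by simp
  qed (auto simp: \<M>_def \<Q>_def intro: pg' without_endpoints_iso co_point_determining_iso)
  show "type_gen_series \<M>c = type_gen_series \<Q>c"
  proof (rule type_gen_series_eqI)
    fix n :: nat
    let ?K = "\<lambda>R. {..<n} \<noteq> {} \<and> (\<forall>u\<in>{..<n}. \<forall>v\<in>{..<n}. (u, v) \<in> R)"
    have "{E. E \<in> simple_graphs {..<n} \<and> standard_graph n E \<in> \<M>c} =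
      {E. E \<in> simple_graphs {..<n} \<and> ?K (E\<^sup>*) \<and> \<not> (\<exists>v\<in>{..<n}. \<exists>t. E `` {v} = {t})}"
      using pg by (auto simp: \<M>c_def iff)
    moreover have "{E. E \<in> simple_graphs {..<n} \<and> standard_graph n E \<in> \<Q>c} =
      {E. E \<in> simple_graphs {..<n} \<and> ?K (E\<^sup>*) \<and> (\<forall>u\<in>{..<n}. \<forall>v\<in>{..<n}. u \<noteq> v \<longrightarrow> \<not> closed_twins E u v)}"
      using pg by (auto simp: \<Q>c_def iff)
    ultimately show "(\<Sum>E | E \<in> simple_graphs {..<n} \<and> standard_graph n E \<in> \<M>c. card (auts {..<n} E))
        = (\<Sum>E | E \<in> simple_graphs {..<n} \<and> standard_graph n E \<in> \<Q>c. card (auts {..<n} E))"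
      using sum_card_auts_leafless_eq_twinfree[of "{..<n}" ?K] by simp
  qed (auto simp: \<M>c_def \<Q>c_def intro: pg' connected_graph_iso without_endpoints_iso co_point_determining_iso)
qed

end
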